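(* For every $0<a<b<\infty$, there exist $k_\star\in\mathbb{N}$ and $\mathcal{C}_\star>0$ such that, for all $k\ge k_\star$, all $t\in[a,b]$, and all $v\in\dot H^1_k(\mathbb{R}^3)$, $$\frac{1}{t\delta_k}\int_{B_{2\sqrt{t\delta_k}}(\Xi_{1,k,t})}|v|^2\,dx\le\frac{\mathcal{C}_\star}{k}\int_{\mathbb{R}^3}|\nabla v|^2\,dx=\mathcal{C}_\star\int_{\Omega_1\times\mathbb{R}}|\nabla v|^2\,dx.$$
   Context: For $k\in\mathbb{N}$, $k\ge2$: $\delta_k=\frac{1}{(k\log k)^2}$. For $t>0$ with $t\delta_k<1$ (which holds for all $t\in[a,b]$ once $k$ is large; the threshold $k_\star$ is understood to be at least that large) and $j\in\{1,\dots,k\}$: $$\xi_{j,k,t}=\sqrt{1-t^2\delta_k^2}\,\big(\cos\tfrac{2\pi(j-1)}{k},\sin\tfrac{2\pi(j-1)}{k}\big)\in\mathbb{R}^2,\qquad \Xi_{j,k,t}=(\xi_{j,k,t},0)\in\mathbb{R}^3.$$ $\Omega_1=\{x\in\mathbb{R}^2:|x-\xi_{1,k,t}|<|x-\xi_{j,k,t}|\text{ for all }j\in\{2,\dots,k\}\}$, equivalently the open sector $\{(r\cos\theta,r\sin\theta):r>0,\ |\theta|<\pi/k\}$. $\dot H^1(\mathbb{R}^3)$ is the homogeneous Sobolev space (completion of $C_c^\infty(\mathbb{R}^3)$ for $\|\nabla v\|_{L^2}$), and $\dot H^1_k(\mathbb{R}^3)$ is the subset of those $v\in\dot H^1(\mathbb{R}^3)$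 that are $k$-fold symmetric in $(x_1,x_2)$: $v(r\cos\theta,r\sin\theta,x_3)=v(r\cos(\theta+\tfrac{2\pi}{k}),r\sin(\theta+\tfrac{2\pi}{k}),x_3)$ for all $r>0$, $\theta\in[0,2\pi)$, $x_3\in\mathbb{R}$. $B_\rho(\Xi)$ is the ball in $\mathbb{R}^3$ of radius $\rho$ centered at $\Xi$. *)

theory Defs
  imports "HOL-Analysis.Analysis"
begin

definition partial :: "'n::finite \<Rightarrow> (real^'n \<Rightarrow> real) \<Rightarrow> real^'n \<Rightarrow> real" where
  "partial i f x = frechet_derivative f (at x) (axis i 1)"

definition grad :: "(real^'n::finite \<Rightarrow> real) \<Rightarrow> real^'n \<Rightarrow> real^'n" where
  "grad f x = (\<chi> i. partial i f x)"

(* All iterated partial derivatives (is ranges over arbitrary lists of indices) are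
   Frechet differentiable everywhere; this is the class C^infinity. *)
definition smooth :: "(real^'n::finite \<Rightarrow> real) \<Rightarrow> bool" where
  "smooth f \<longleftrightarrow> (\<forall>is x. foldr partial is f differentiable (at x))"

definition test_functions :: "(real^'n::finite \<Rightarrow> real) set" where
  "test_functions = {f. smooth f \<and> compact (closure {x. f x \<noteq> 0})}"

definition locally_integrable :: "(real^'n::finite \<Rightarrow> 'b::euclidean_space) \<Rightarrow> bool" where
  "locally_integrable f \<longleftrightarrow> (\<forall>K. compact K \<longrightarrow> set_integrable lebesgue K f)"

definition has_weak_gradient ::
    "(real^'n::finite \<Rightarrow> real) \<Rightarrow> (real^'n \<Rightarrow> real^'n) \<Rightarrow> bool" where
  "has_weak_gradient v G \<longleftrightarrow> locally_integrable v \<and> locally_integrable G \<and>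
     (\<forall>\<phi>\<in>test_functions. \<forall>i.
        (LINT x|lebesgue. v x * partial i \<phi> x) = - (LINT x|lebesgue. G x $ i * \<phi> x))"

(* The weak gradient is unique only up to null sets; SOME picks a representative, which
   is immaterial since weak_gradient is only used under integrals. *)
definition weak_gradient :: "(real^'n::finite \<Rightarrow> real) \<Rightarrow> real^'n \<Rightarrow> real^'n" where
  "weak_gradient v = (SOME G. has_weak_gradient v G)"

(* The completion of the test functions for the norm of the gradient in L^2, realized as a
   space of functions: by the Sobolev inequality a sequence that is Cauchy for this norm
   converges in L^6(R^3), and its L^6 limit is the function that represents the element of
   the completion. Elements are representatives, not classes modulo null sets.
   The integrability clauses ensure that no integral in the two limits is
   that of a non-integrable function (which would be 0 by convention). *)
definition homogeneous_H1 :: "(real^3 \<Rightarrow> real) set" where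
  "homogeneous_H1 = {v.
     v \<in> borel_measurable lebesgue \<and>
     integrable lebesgue (\<lambda>x. \<bar>v x\<bar> ^ 6) \<and>
     (\<exists>G. has_weak_gradient v G) \<and>
     integrable lebesgue (\<lambda>x. (norm (weak_gradient v x))\<^sup>2) \<and>
     (\<exists>\<phi>. (\<forall>n. \<phi> n \<in> test_functions) \<and>
       (\<lambda>n. LINT x|lebesgue. \<bar>\<phi> n x - v x\<bar> ^ 6) \<longlonglongrightarrow> 0 \<and>
       (\<lambda>n. LINT x|lebesgue. (norm (grad (\<phi> n) x - weak_gradient v x))\<^sup>2) \<longlonglongrightarrow> 0)}"

(* Invariance of v under the rotation by 2 pi / k about the x_3-axis, almost everywhere
   because v stands for its class modulo null sets. *)
definition fold_symmetric :: "nat \<Rightarrow> (real^3 \<Rightarrow> real) \<Rightarrow> bool" where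
  "fold_symmetric k v \<longleftrightarrow> (AE x in lebesgue. \<forall>r>0. \<forall>\<theta>\<in>{0..<2*pi}.
     x = vector [r * cos \<theta>, r * sin \<theta>, x$3] \<longrightarrow>
     v x = v (vector [r * cos (\<theta> + 2*pi / real k), r * sin (\<theta> + 2*pi / real k), x$3]))"

definition homogeneous_H1_sym :: "nat \<Rightarrow> (real^3 \<Rightarrow> real) set" where
  "homogeneous_H1_sym k = {v \<in> homogeneous_H1. fold_symmetric k v}"

definition \<delta> :: "nat \<Rightarrow> real" where
  "\<delta> k = 1 / (real k * ln (real k))\<^sup>2"

definition \<xi> :: "nat \<Rightarrow> nat \<Rightarrow> real \<Rightarrow> real^2" where
  "\<xi> j k t = sqrt (1 - t\<^sup>2 * (\<delta> k)\<^sup>2) *\<^sub>R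
     vector [cos (2*pi * (real j - 1) / real k), sin (2*pi * (real j - 1) / real k)]"

definition \<Xi> :: "nat \<Rightarrow> nat \<Rightarrow> real \<Rightarrow> real^3" where
  "\<Xi> j k t = vector [\<xi> j k t $ 1, \<xi> j k t $ 2, 0]"

definition \<Omega>\<^sub>1 :: "nat \<Rightarrow> real \<Rightarrow> (real^2) set" where
  "\<Omega>\<^sub>1 k t = {x. \<forall>j\<in>{2..k}. norm (x - \<xi> 1 k t) < norm (x - \<xi> j k t)}"

(* S \<times> R as a subset of R^3. *)
definition cylinder :: "(real^2) set \<Rightarrow> (real^3) set" where
  "cylinder S = {x. vector [x$1, x$2] \<in> S}"

end

theory Submission
  imports Defs
begin

text \<open>Put \<open>\<rho> = sqrt (t \<delta>\<^sub>k)\<close> and let \<open>W\<close> be the sum over \<open>j\<close> of \<open>\<rho> / sqrt (\<rho>\<^sup>2 + |x - \<Xi>\<^sub>j|\<^sup>2)\<close>. Each summand is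
  positive and superharmonic, with \<open>-\<Delta>\<close> of order \<open>\<rho>\<^sup>-\<^sup>2\<close> on \<open>B\<^sub>2\<^sub>\<rho>(\<Xi>\<^sub>j)\<close>, and \<open>W \<le> 1 + C \<rho> k log k\<close> because the
  \<open>\<Xi>\<^sub>j\<close> are spaced like \<open>1/k\<close>; the choice of \<open>\<delta>\<^sub>k\<close> makes this a bounded quantity. The ground state inequality
  \<open>\<integral>(-\<Delta>W / W) \<phi>\<^sup>2 \<le> \<integral>|\<nabla>\<phi>|\<^sup>2\<close> for test functions \<open>\<phi>\<close> then bounds the sum over \<open>j\<close> of
  \<open>\<rho>\<^sup>-\<^sup>2 \<integral>\<phi>\<^sup>2\<close> over \<open>B\<^sub>2\<^sub>\<rho>(\<Xi>\<^sub>j)\<close> by a constant times \<open>\<integral>|\<nabla>\<phi>|\<^sup>2\<close>, and this passes to the completion. For a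
  \<open>k\<close>-fold symmetric function the \<open>k\<close> summands agree. The gradient of such a function has rotation invariant norm, so
  its energy is distributed equally over the \<open>k\<close> Voronoi cells of the points \<open>\<Xi>\<^sub>j\<close>, the first of which
  is \<open>\<Omega>\<^sub>1 \<times> \<real>\<close>.\<close>

section \<open>Orthogonal invariance and integration of partial derivatives\<close>

text \<open>The point is to gain the factor \<open>1/k\<close>. A single bubble would bound the
  integral over one ball by the full energy; the gain arises because one weight charges all
  \<open>k\<close> balls to the same energy, and the price is only the supremum of \<open>W\<close>.
  In dimension three a bubble decays like \<open>\<rho>\<close> over the distance, and its centres
  lie along a curve, so the tails add up to a harmonic sum: this is the origin of
  \<open>\<rho> k log k\<close>. Since \<open>\<rho> = sqrt t / (k log k)\<close>, that quantity
  equals \<open>sqrt t\<close>. The other obstacle is the gradient. \<open>weak_gradient\<close>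
  picks an arbitrary representative, so its behaviour under rotation cannot be read off by
  differentiating. What settles it is the approximating sequence that membership in the completion
  provides: along such sequences the gradient is a closed operator, hence determined by the function
  up to null sets. Convergence arguments avoid Holder's inequality; pointwise inequalities with a
  free parameter take its place.\<close>

lemma lborel_distr_orthogonal_transformation:
  fixes f :: "real^'n::{finite,wellorder} \<Rightarrow> real^'n::_"
  assumes f: "orthogonal_transformation f"
  shows "distr lborel borel f = lborel"
proof (rule lborel_eqI[symmetric])
  fix l u :: "real^'n::{finite,wellorder}"
  assume le: "\<And>b. b \<in> Basis \<Longrightarrow> l \<bullet> b \<le> u \<bullet> b"
  have bij: "bij f" using f by (rule orthogonal_transformation_bij)
  have f_borel: "f \<in> borel_measurable borel"
    using f by (intro borel_measurable_continuous_onI linear_continuous_on linear_linear[THEN iffD2])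
      (auto dest: orthogonal_transformation_linear)
  have inv: "orthogonal_transformation (inv f)"
    using f by (rule orthogonal_transformation_inv)
  \<comment> \<open>Boxes determine \<open>lborel\<close>. The preimage of a box is its image under
    the inverse, again an orthogonal map, so the known invariance of the measure of images
    applies.\<close>
  have img: "f -` box l u = inv f ` box l u"
    using bij by (rule bij_vimage_eq_inv_image)
  have borel: "f -` box l u \<in> sets borel"
    using measurable_sets[OF f_borel, of "box l u"] by simp
  have "inv f ` box l u \<in> lmeasurable"
    using inv by (rule measurable_orthogonal_image) simp
  then have "emeasure lebesgue (f -` box l u) = measure lebesgue (f -` box l u)"
    unfolding img by (rule emeasure_eq_measure2)
  also have "\<dots> = measure lebesgue (box l u)"
    unfolding img by (simp add: measure_orthogonal_image[OF inv])
  also have "\<dots> = (\<Prod>b\<in>Basis. (u - l) \<bullet> b)"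
    using le by (simp add: measure_lborel_box_eq)
  finally show "emeasure (distr lborel borel f) (box l u) = (\<Prod>b\<in>Basis. (u - l) \<bullet> b)"
    using borel by (subst emeasure_distr) (auto simp: f_borel)
qed simp

text \<open>Composition with a Borel map alone can destroy Lebesgue measurability. Here preimages of
  null sets are null, because \<open>f\<close> preserves \<open>lborel\<close>, and so the
  invariance lifts to the completion.\<close>

lemma
  fixes f :: "real^'n::{finite,wellorder} \<Rightarrow> real^'n::_"
  assumes f: "orthogonal_transformation f"
  shows measurable_lebesgue_orthogonal_transformation: "f \<in> lebesgue \<rightarrow>\<^sub>M lebesgue"
    and lebesgue_distr_orthogonal_transformation: "distr lebesgue lebesgue f = lebesgue"
proof -
  have f_borel: "f \<in> borel_measurable borel"
    using f by (intro borel_measurable_continuous_onI linear_continuous_on linear_linear[THEN iffD2])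
      (auto dest: orthogonal_transformation_linear)
  then have f_lborel: "f \<in> lborel \<rightarrow>\<^sub>M lborel"
    by simp
  then have f_leb: "f \<in> lebesgue \<rightarrow>\<^sub>M lborel"
    by (rule measurable_completion)
  have "distr lebesgue lborel f = distr lborel lborel f"
    using f_lborel by (rule distr_completion)
  also have "\<dots> = lborel"
    using lborel_distr_orthogonal_transformation[OF f] by (simp cong: distr_cong)
  finally have eq: "distr lebesgue lborel f = lborel" .
  show meas: "f \<in> lebesgue \<rightarrow>\<^sub>M lebesgue"
    by (rule completion.measurable_completion2) (use f_leb eq in auto)
  have "completion (distr lebesgue lborel f) = distr lebesgue lebesgue f"
    by (rule completion.completion_distr_eq) (use f_leb eq in auto)
  then show "distr lebesgue lebesgue f = lebesgue"
    by (simp add: eq)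
qed

context
  fixes f :: "real^'n::{finite,wellorder} \<Rightarrow> real^'n::_"
  assumes f: "orthogonal_transformation f"
begin

lemma borel_measurable_lebesgue_orthogonal:
  "g \<in> borel_measurable lebesgue \<Longrightarrow> (\<lambda>x. g (f x)) \<in> borel_measurable lebesgue"
  using measurable_compose[OF measurable_lebesgue_orthogonal_transformation[OF f]] .

lemma integral_lebesgue_orthogonal:
  fixes g :: "real^'n::_ \<Rightarrow> 'b::{banach,second_countable_topology}"
  assumes "g \<in> borel_measurable lebesgue"
  shows "(LINT x|lebesgue. g (f x)) = (LINT x|lebesgue. g x)"
  using integral_distr[OF measurable_lebesgue_orthogonal_transformation[OF f] assms]
  by (simp add: lebesgue_distr_orthogonal_transformation[OF f])

lemma integrable_lebesgue_orthogonal: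
  fixes g :: "real^'n::_ \<Rightarrow> 'b::{banach,second_countable_topology}"
  assumes "integrable lebesgue g"
  shows "integrable lebesgue (\<lambda>x. g (f x))"
  using integrable_distr[OF measurable_lebesgue_orthogonal_transformation[OF f], of g] assms
  by (simp add: lebesgue_distr_orthogonal_transformation[OF f])

end

section \<open>Integrals of partial derivatives of functions with bounded support\<close>

lemma integrable_continuous_bounded_support:
  fixes f :: "'a::euclidean_space \<Rightarrow> 'b::{banach,second_countable_topology}"
  assumes f: "continuous_on UNIV f" and B: "\<And>x. B < norm x \<Longrightarrow> f x = 0"
  shows "integrable lborel f"
proof -
  have "integrable lborel (\<lambda>x. indicator (cball 0 B) x *\<^sub>R f x)"
    using f by (intro borel_integrable_compact) (auto intro: continuous_on_subset)
  also have "(\<lambda>x. indicator (cball 0 B) x *\<^sub>R f x) = f"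
    using B by (auto simp: indicator_def fun_eq_iff not_le)
  finally show ?thesis .
qed

lemma integrable_lebesgue_continuous_bounded_support:
  fixes f :: "'a::euclidean_space \<Rightarrow> 'b::{banach,second_countable_topology}"
  assumes "continuous_on UNIV f" and "\<And>x. B < norm x \<Longrightarrow> f x = 0"
  shows "integrable lebesgue f"
  using integrable_continuous_bounded_support[OF assms]
    borel_measurable_continuous_onI[OF assms(1)] by (subst integrable_completion) auto

lemma has_derivative_grad:
  fixes f :: "real^'n::finite \<Rightarrow> real"
  assumes "f differentiable at x"
  shows "(f has_derivative (\<lambda>h. grad f x \<bullet> h)) (at x)"
proof -
  let ?D = "frechet_derivative f (at x)"
  have D: "(f has_derivative ?D) (at x)"
    using assms by (rule frechet_derivative_works[THEN iffD1])
  then have lin: "linear ?D"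
    by (rule has_derivative_linear)
  have "?D h = grad f x \<bullet> h" for h
  proof -
    have "?D h = ?D (\<Sum>i\<in>UNIV. (h $ i) *\<^sub>R axis i 1)"
      using basis_expansion[of h] by (simp add: scalar_mult_eq_scaleR)
    also have "\<dots> = (\<Sum>i\<in>UNIV. (h $ i) * ?D (axis i 1))"
      by (simp add: linear_sum[OF lin] linear_cmul[OF lin])
    also have "\<dots> = grad f x \<bullet> h"
      by (simp add: grad_def partial_def inner_vec_def mult.commute)
    finally show ?thesis .
  qed
  then have "?D = (\<lambda>h. grad f x \<bullet> h)"
    by (rule ext)
  with D show ?thesis by (rule back_subst[where P = "\<lambda>D. (f has_derivative D) (at x)"])
qed

lemma partial_eqI:
  assumes "(f has_derivative f') (at x)"
  shows "partial i f x = f' (axis i 1)"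
  using frechet_derivative_at[OF assms] by (simp add: partial_def)

lemma grad_eqI:
  assumes "(f has_derivative (\<lambda>h. g \<bullet> h)) (at x)"
  shows "grad f x = g"
  by (simp add: vec_eq_iff grad_def partial_eqI[OF assms] inner_axis)

lemma partial_eq_0_of_norm_gt:
  assumes B: "\<And>x. B < norm x \<Longrightarrow> f x = 0" and x: "B < norm x"
  shows "partial i f x = 0"
proof -
  have "((\<lambda>x. 0::real) has_derivative (\<lambda>h. 0)) (at x)"
    by simp
  then have "(f has_derivative (\<lambda>h. 0)) (at x)"
  proof (rule has_derivative_transform_within_open)
    show "open {x. B < norm x}"
      by (intro open_Collect_less continuous_intros)
  qed (use B x in auto)
  from partial_eqI[OF this] show ?thesis by simp
qed

lemma has_real_derivative_along_axis:
  assumes "f differentiable at (x + t *\<^sub>R axis i 1)"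
  shows "((\<lambda>t. f (x + t *\<^sub>R axis i 1)) has_real_derivative partial i f (x + t *\<^sub>R axis i 1)) (at t)"
proof -
  let ?D = "frechet_derivative f (at (x + t *\<^sub>R axis i 1))"
  have D: "(f has_derivative ?D) (at (x + t *\<^sub>R axis i 1))"
    using assms by (rule frechet_derivative_works[THEN iffD1])
  have "((\<lambda>t. x + t *\<^sub>R axis i 1) has_derivative (\<lambda>h. h *\<^sub>R axis i 1)) (at t)"
    by (auto intro!: derivative_eq_intros)
  from diff_chain_at[OF this D]
  have "((\<lambda>t. f (x + t *\<^sub>R axis i 1)) has_derivative (\<lambda>h. ?D (h *\<^sub>R axis i 1))) (at t)"
    by (simp add: o_def)
  moreover have "?D (h *\<^sub>R axis i 1) = partial i f (x + t *\<^sub>R axis i 1) * h" for h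
    using linear_cmul[OF has_derivative_linear[OF D], of h "axis i 1"]
    by (simp add: partial_def mult.commute)
  ultimately show ?thesis
    by (simp add: has_field_derivative_def)
qed

lemma integral_lborel_translation:
  fixes f :: "'a::euclidean_space \<Rightarrow> real"
  assumes "f \<in> borel_measurable borel"
  shows "(LINT x|lborel. f (c + x)) = (LINT x|lborel. f x)"
  using integral_distr[of "(+) c" lborel borel f] assms by (simp add: lborel_distr_plus)

text \<open>Difference quotients have integral zero by translation invariance, and dominated
  convergence carries this to the derivative, without iterated integrals.\<close>

lemma integral_partial_eq_0:
  fixes f :: "real^'n::finite \<Rightarrow> real"
  assumes diff: "\<And>x. f differentiable at x"
    and cont: "continuous_on UNIV (partial i f)"
    and B: "\<And>x. B < norm x \<Longrightarrow> f x = 0"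
  shows "(LINT x|lebesgue. partial i f x) = 0"
proof -
  let ?e = "axis i 1 :: real^'n"
  define s where "s n x = (f (inverse (real (Suc n)) *\<^sub>R ?e + x) - f x) * real (Suc n)" for n x
  have cf: "continuous_on UNIV f"
    using diff by (simp add: continuous_on_eq_continuous_at differentiable_imp_continuous_within)
  have f_meas [measurable]: "f \<in> borel_measurable borel"
    using cf by (rule borel_measurable_continuous_onI)
  have p_meas [measurable]: "partial i f \<in> borel_measurable borel"
    using cont by (rule borel_measurable_continuous_onI)
  have int_f: "integrable lborel f"
    using cf B by (rule integrable_continuous_bounded_support)
  have "bounded (partial i f ` cball 0 (B + 2))"
    using cont by (intro compact_imp_bounded compact_continuous_image)
      (auto intro: continuous_on_subset)
  then obtain C where C: "\<And>x. norm x \<le> B + 2 \<Longrightarrow> \<bar>partial i f x\<bar> \<le> C"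
    unfolding bounded_iff by force
  have mvt: "\<exists>z. 0 < z \<and> z < h \<and> f (x + h *\<^sub>R ?e) - f x = h * partial i f (x + z *\<^sub>R ?e)"
    if "0 < h" for h x
    using MVT2[OF that, of "\<lambda>t. f (x + t *\<^sub>R ?e)" "\<lambda>t. partial i f (x + t *\<^sub>R ?e)"]
      has_real_derivative_along_axis[OF diff] by auto
  \<comment> \<open>By the mean value theorem \<open>s n x\<close> is a value of the partial
    derivative at distance at most 1 from \<open>x\<close>. If \<open>x\<close> lies outside radius
    \<open>B + 1\<close>, that value is still 0; otherwise the point lies within
    \<open>B + 2\<close>, where \<open>C\<close> is a bound.\<close>
  have bound: "norm (s n x) \<le> indicator (cball 0 (B + 1)) x * C" for n x
  proof -
    define h where "h = inverse (real (Suc n))"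
    have h: "0 < h" "h \<le> 1" "real (Suc n) = inverse h"
      by (auto simp: h_def inverse_eq_divide)
    obtain z where z: "0 < z" "z < h" "f (x + h *\<^sub>R ?e) - f x = h * partial i f (x + z *\<^sub>R ?e)"
      using mvt[OF h(1)] by blast
    have s: "s n x = partial i f (x + z *\<^sub>R ?e)"
      using z(3) h(1) unfolding s_def h(3) by (simp add: add.commute)
    have nz: "norm (z *\<^sub>R ?e) \<le> 1" using z h by simp
    show ?thesis
    proof (cases "norm x \<le> B + 1")
      case True
      then have "norm (x + z *\<^sub>R ?e) \<le> B + 2"
        using nz norm_triangle_ineq[of x "z *\<^sub>R ?e"] by linarith
      then show ?thesis using C True s by simp
    next
      case False
      then have "B < norm (x + z *\<^sub>R ?e)"
        using nz norm_triangle_ineq4[of "x + z *\<^sub>R ?e" "z *\<^sub>R ?e"] by simp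
      then have "s n x = 0"
        using partial_eq_0_of_norm_gt[OF B] s by simp
      then show ?thesis using False by simp
    qed
  qed
  have lim: "(\<lambda>n. s n x) \<longlonglongrightarrow> partial i f x" for x
  proof -
    have "((\<lambda>t. f (x + t *\<^sub>R ?e)) has_real_derivative partial i f x) (at 0)"
      using has_real_derivative_along_axis[of f x 0 i] diff by simp
    then have "(\<lambda>h. (f (x + h *\<^sub>R ?e) - f x) / h) \<midarrow>0\<rightarrow> partial i f x"
      by (simp add: DERIV_def)
    moreover have "filterlim (\<lambda>n. inverse (real (Suc n))) (at 0) sequentially"
      unfolding filterlim_at using LIMSEQ_inverse_real_of_nat by auto
    ultimately have "(\<lambda>n. (f (x + inverse (real (Suc n)) *\<^sub>R ?e) - f x) / inverse (real (Suc n))) \<longlonglongrightarrow> partial i f x"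
      by (rule filterlim_compose)
    then show ?thesis
      by (simp add: s_def divide_inverse add.commute)
  qed
  have "(\<lambda>n. LINT x|lborel. s n x) \<longlonglongrightarrow> (LINT x|lborel. partial i f x)"
  proof (rule integral_dominated_convergence)
    show "integrable lborel (\<lambda>x. indicator (cball 0 (B + 1)) x * C)"
      by (intro integrable_mult_left integrable_real_indicator) (auto simp: emeasure_lborel_cball_finite[unfolded infinity_ennreal_def])
  qed (use bound lim in \<open>auto simp: s_def\<close>)
  moreover have "(LINT x|lborel. s n x) = 0" for n
  proof -
    have "integrable lborel (\<lambda>x. f (inverse (real (Suc n)) *\<^sub>R ?e + x))"
      using integrable_distr[of "(+) (inverse (real (Suc n)) *\<^sub>R ?e)" lborel borel f] int_f
      by (simp add: lborel_distr_plus)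
    then show ?thesis
      using int_f integral_lborel_translation[OF f_meas]
      by (simp add: s_def)
  qed
  ultimately have "(LINT x|lborel. partial i f x) = 0"
    by (simp add: LIMSEQ_const_iff)
  then show ?thesis
    by (simp add: integral_completion)
qed

section \<open>Square-integrable limits and twice differentiable functions of bounded support\<close>

text \<open>Measurability is a separate clause, since a measurable norm does not make the function
  measurable.\<close>

definition square_integrable :: "'a measure \<Rightarrow> ('a \<Rightarrow> 'b::euclidean_space) \<Rightarrow> bool" where
  "square_integrable M f \<longleftrightarrow> f \<in> borel_measurable M \<and> integrable M (\<lambda>x. (norm (f x))\<^sup>2)"

lemma norm_diff_square_le:
  fixes a b :: "'a::real_inner"
  shows "(norm (a - b))\<^sup>2 \<le> 2 * (norm a)\<^sup>2 + 2 * (norm b)\<^sup>2"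
proof -
  have "(norm (a - b))\<^sup>2 + (norm (a + b))\<^sup>2 = 2 * (norm a)\<^sup>2 + 2 * (norm b)\<^sup>2"
    by (simp add: power2_norm_eq_inner algebra_simps)
  then show ?thesis
    by (smt (verit) zero_le_power2)
qed

lemma square_integrable_diff:
  assumes f: "square_integrable M f" and g: "square_integrable M g"
  shows "square_integrable M (\<lambda>x. f x - g x)"
proof -
  have [measurable]: "f \<in> borel_measurable M" "g \<in> borel_measurable M"
    using f g by (auto simp: square_integrable_def)
  have "integrable M (\<lambda>x. (norm (f x - g x))\<^sup>2)"
  proof (rule Bochner_Integration.integrable_bound)
    show "integrable M (\<lambda>x. 2 * (norm (f x))\<^sup>2 + 2 * (norm (g x))\<^sup>2)"
      using f g by (auto simp: square_integrable_def)
    show "AE x in M. norm ((norm (f x - g x))\<^sup>2) \<le> norm (2 * (norm (f x))\<^sup>2 + 2 * (norm (g x))\<^sup>2)"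
      using norm_diff_square_le by (intro AE_I2) simp
  qed simp
  then show ?thesis by (simp add: square_integrable_def)
qed

text \<open>Polarization expresses the inner product through three integrable squared norms.\<close>

lemma integrable_inner_square_integrable:
  assumes f: "square_integrable M f" and g: "square_integrable M g"
  shows "integrable M (\<lambda>x. f x \<bullet> g x)"
proof -
  have [measurable]: "f \<in> borel_measurable M" "g \<in> borel_measurable M"
    using f g by (auto simp: square_integrable_def)
  have eq: "(\<lambda>x. f x \<bullet> g x) = (\<lambda>x. ((norm (f x))\<^sup>2 + (norm (g x))\<^sup>2 - (norm (f x - g x))\<^sup>2) / 2)"
    by (simp add: fun_eq_iff power2_norm_eq_inner inner_diff_left inner_diff_right inner_commute)
  show ?thesis
    unfolding eq using f g square_integrable_diff[OF f g] by (simp add: square_integrable_def)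
qed

text \<open>Stands in for Holder's inequality: an inequality of Young type gives a small error
  \<open>e\<close> and a factor \<open>K\<close> that may blow up as \<open>e\<close> tends to 0,
  which is harmless because \<open>K\<close> is fixed before \<open>n\<close> grows.\<close>

lemma tendsto_0_of_weighted_bound:
  fixes a c :: "nat \<Rightarrow> real"
  assumes a: "a \<longlonglongrightarrow> 0" and c: "\<And>e. 0 < e \<Longrightarrow> \<exists>K. \<forall>n. \<bar>c n\<bar> \<le> e + K * a n"
  shows "c \<longlonglongrightarrow> 0"
proof (rule LIMSEQ_I)
  fix r :: real assume r: "0 < r"
  then obtain K where K: "\<And>n. \<bar>c n\<bar> \<le> r / 2 + K * a n"
    using c[of "r / 2"] by auto
  have "(\<lambda>n. K * a n) \<longlonglongrightarrow> 0"
    using tendsto_mult_left[OF a, of K] by simp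
  then have "\<forall>\<^sub>F n in sequentially. K * a n < r / 2"
    using r by (intro order_tendstoD) auto
  then obtain N where N: "\<And>n. N \<le> n \<Longrightarrow> K * a n < r / 2"
    by (auto simp: eventually_sequentially)
  have "norm (c n - 0) < r" if "N \<le> n" for n
    using K[of n] N[OF that] by simp
  then show "\<exists>N. \<forall>n\<ge>N. norm (c n - 0) < r"
    by blast
qed

lemma integral_inner_tendsto:
  assumes f: "\<And>n. square_integrable M (f n)" and F: "square_integrable M F"
    and g: "square_integrable M g"
    and lim: "(\<lambda>n. LINT x|M. (norm (f n x - F x))\<^sup>2) \<longlonglongrightarrow> 0"
  shows "(\<lambda>n. LINT x|M. f n x \<bullet> g x) \<longlonglongrightarrow> (LINT x|M. F x \<bullet> g x)"
proof -
  define C where "C = (LINT x|M. (norm (g x))\<^sup>2)"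
  have C: "0 \<le> C" by (simp add: C_def)
  have "(\<lambda>n. (LINT x|M. f n x \<bullet> g x) - (LINT x|M. F x \<bullet> g x)) \<longlonglongrightarrow> 0"
  proof (rule tendsto_0_of_weighted_bound[OF lim])
    fix e :: real assume e: "0 < e"
    \<comment> \<open>Weight for Young's inequality that keeps the \<open>g\<close> part below
      \<open>e\<close>; the added 1 covers the case \<open>C = 0\<close>.\<close>
    define s where "s = e / (C + 1)"
    have s: "0 < s" "s * C \<le> e"
      using e C by (auto simp: s_def field_simps)
    have "\<bar>(LINT x|M. f n x \<bullet> g x) - (LINT x|M. F x \<bullet> g x)\<bar>
        \<le> e + 1 / s * (LINT x|M. (norm (f n x - F x))\<^sup>2)" for n
    proof -
      let ?h = "\<lambda>x. f n x - F x"
      have h: "square_integrable M ?h"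
        using f F by (rule square_integrable_diff)
      have "(LINT x|M. f n x \<bullet> g x) - (LINT x|M. F x \<bullet> g x) = (LINT x|M. ?h x \<bullet> g x)"
        using integrable_inner_square_integrable[OF f g] integrable_inner_square_integrable[OF F g]
        by (subst Bochner_Integration.integral_diff[symmetric]) (auto simp: inner_diff_left)
      also have "\<bar>\<dots>\<bar> \<le> (LINT x|M. \<bar>?h x \<bullet> g x\<bar>)"
        by (rule integral_abs_bound)
      also have "\<dots> \<le> (LINT x|M. s * (norm (g x))\<^sup>2 + 1 / s * (norm (?h x))\<^sup>2)"
      proof (rule integral_mono)
        fix x
        \<comment> \<open>Young's inequality with weight \<open>s\<close>, with a factor 2 given
          away.\<close>
        have "0 \<le> (norm (g x) * s - norm (?h x))\<^sup>2" by simp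
        then have "2 * (norm (?h x) * norm (g x) * s) \<le> (norm (g x) * s)\<^sup>2 + (norm (?h x))\<^sup>2"
          unfolding power2_diff by (simp add: mult_ac)
        moreover have "0 \<le> norm (?h x) * norm (g x) * s"
          using s by simp
        ultimately have "norm (?h x) * norm (g x) * s \<le> (norm (g x) * s)\<^sup>2 + (norm (?h x))\<^sup>2"
          by linarith
        then have "norm (?h x) * norm (g x) \<le> s * (norm (g x))\<^sup>2 + 1 / s * (norm (?h x))\<^sup>2"
          using s by (simp add: field_simps power2_eq_square)
        then show "\<bar>?h x \<bullet> g x\<bar> \<le> s * (norm (g x))\<^sup>2 + 1 / s * (norm (?h x))\<^sup>2"
          using Cauchy_Schwarz_ineq2[of "?h x" "g x"] by linarith
      qed (use h g integrable_inner_square_integrable[OF h g] in \<open>auto simp: square_integrable_def\<close>)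
      also have "\<dots> = s * C + 1 / s * (LINT x|M. (norm (?h x))\<^sup>2)"
        using h g by (subst Bochner_Integration.integral_add) (auto simp: square_integrable_def C_def)
      finally show ?thesis using s by linarith
    qed
    then show "\<exists>K. \<forall>n. \<bar>(LINT x|M. f n x \<bullet> g x) - (LINT x|M. F x \<bullet> g x)\<bar>
        \<le> e + K * (LINT x|M. (norm (f n x - F x))\<^sup>2)"
      by blast
  qed
  then show ?thesis by (simp add: LIM_zero_iff)
qed

text \<open>In |f|^2 = |f - F|^2 + 2 f.F - |F|^2 the first term vanishes in the limit and the cross
  term is a pairing with the fixed function \<open>F\<close>.\<close>

lemma integral_norm_square_tendsto:
  assumes f: "\<And>n. square_integrable M (f n)" and F: "square_integrable M F"
    and lim: "(\<lambda>n. LINT x|M. (norm (f n x - F x))\<^sup>2) \<longlonglongrightarrow> 0"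
  shows "(\<lambda>n. LINT x|M. (norm (f n x))\<^sup>2) \<longlonglongrightarrow> (LINT x|M. (norm (F x))\<^sup>2)"
proof -
  have "(\<lambda>n. (LINT x|M. (norm (f n x - F x))\<^sup>2) + 2 * (LINT x|M. f n x \<bullet> F x) - (LINT x|M. F x \<bullet> F x))
      \<longlonglongrightarrow> 0 + 2 * (LINT x|M. F x \<bullet> F x) - (LINT x|M. F x \<bullet> F x)"
    by (intro tendsto_intros lim integral_inner_tendsto f F)
  moreover have "(LINT x|M. (norm (f n x - F x))\<^sup>2) + 2 * (LINT x|M. f n x \<bullet> F x) - (LINT x|M. F x \<bullet> F x)
      = (LINT x|M. (norm (f n x))\<^sup>2)" for n
  proof -
    have "(LINT x|M. (norm (f n x))\<^sup>2)
        = (LINT x|M. (norm (f n x - F x))\<^sup>2 + 2 * (f n x \<bullet> F x) - F x \<bullet> F x)"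
      by (intro Bochner_Integration.integral_cong)
        (simp_all add: power2_norm_eq_inner inner_diff_left inner_diff_right inner_commute)
    also have "\<dots> = (LINT x|M. (norm (f n x - F x))\<^sup>2) + 2 * (LINT x|M. f n x \<bullet> F x) - (LINT x|M. F x \<bullet> F x)"
      using square_integrable_diff[OF f F, of n] integrable_inner_square_integrable[OF f F, of n]
        integrable_inner_square_integrable[OF F F]
      by (simp add: square_integrable_def)
    finally show ?thesis by simp
  qed
  ultimately show ?thesis by (simp add: power2_norm_eq_inner)
qed

text \<open>Large enough to contain the test functions, yet stable under differences and orthogonal
  substitutions with only two orders of derivatives to follow. The mixed second partials are
  included because a rotation mixes them with the pure ones.\<close>

definition C2c :: "(real^'n::finite \<Rightarrow> real) set" where
  "C2c = {f. (\<forall>x. f differentiable (at x)) \<and> (\<forall>i x. partial i f differentiable (at x)) \<and>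
     (\<forall>i j. continuous_on UNIV (partial j (partial i f))) \<and> (\<exists>B. \<forall>x. B < norm x \<longrightarrow> f x = 0)}"

lemma continuous_on_differentiable:
  assumes "\<And>x. f differentiable (at x)"
  shows "continuous_on UNIV f"
  using assms by (simp add: continuous_on_eq_continuous_at differentiable_imp_continuous_within)

lemma
  assumes "f \<in> C2c"
  shows C2c_differentiable: "f differentiable (at x)"
    and C2c_partial_differentiable: "partial i f differentiable (at x)"
    and C2c_continuous: "continuous_on UNIV f"
    and C2c_partial_continuous: "continuous_on UNIV (partial i f)"
    and C2c_partial_partial_continuous: "continuous_on UNIV (partial j (partial i f))"
    and C2c_grad_continuous: "continuous_on UNIV (grad f)"
  using assms unfolding C2c_def grad_def
  by (auto intro!: continuous_on_differentiable continuous_on_vec_lambda simp: eta_contract_eq)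

lemma C2c_support:
  assumes "f \<in> C2c"
  obtains B where "\<And>x. B < norm x \<Longrightarrow> f x = 0"
    "\<And>x i. B < norm x \<Longrightarrow> partial i f x = 0"
    "\<And>x i j. B < norm x \<Longrightarrow> partial j (partial i f) x = 0"
    "\<And>x. B < norm x \<Longrightarrow> grad f x = 0"
proof -
  obtain B where B: "\<And>x. B < norm x \<Longrightarrow> f x = 0"
    using assms by (auto simp: C2c_def)
  show thesis
    by (rule that[of B])
      (auto simp: grad_def vec_eq_iff intro!: B partial_eq_0_of_norm_gt)
qed

lemma test_functions_subset_C2c: "test_functions \<subseteq> C2c"
proof
  fix f :: "real^'n \<Rightarrow> real" assume "f \<in> test_functions"
  then have d: "\<And>is x. foldr partial is f differentiable (at x)"
    and c: "compact (closure {x. f x \<noteq> 0})"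
    by (auto simp: test_functions_def smooth_def)
  obtain B where "\<forall>x\<in>closure {x. f x \<noteq> 0}. norm x \<le> B"
    using compact_imp_bounded[OF c] by (auto simp: bounded_iff)
  then have "\<forall>x. B < norm x \<longrightarrow> f x = 0"
    using closure_subset[of "{x. f x \<noteq> 0}"] by (metis (mono_tags, lifting) mem_Collect_eq not_le subsetD)
  \<comment> \<open>Index lists of length 0 and 1 give the differentiability clauses; length 2 gives
    differentiable, hence continuous, second partials.\<close>
  then show "f \<in> C2c"
    using d[of "[]"] d[of "[_]"] continuous_on_differentiable[OF d[of "[_, _]"]]
    by (auto simp: C2c_def)
qed

lemma partial_diff:
  assumes "f differentiable (at x)" "g differentiable (at x)"
  shows "partial i (\<lambda>x. f x - g x) x = partial i f x - partial i g x"
  using partial_eqI[OF has_derivative_diff[OF has_derivative_grad[OF assms(1)] has_derivative_grad[OF assms(2)]], of i]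
  by (simp add: grad_def inner_axis)

lemma partial_mult:
  assumes "f differentiable (at x)" "g differentiable (at x)"
  shows "partial i (\<lambda>x. f x * g x) x = partial i f x * g x + f x * partial i g x"
  using partial_eqI[OF has_derivative_mult[OF has_derivative_grad[OF assms(1)] has_derivative_grad[OF assms(2)]], of i]
  by (simp add: grad_def inner_axis)

lemma C2c_diff:
  assumes f: "f \<in> C2c" and g: "g \<in> C2c"
  shows "(\<lambda>x. f x - g x) \<in> C2c" and "grad (\<lambda>x. f x - g x) x = grad f x - grad g x"
proof -
  have p: "partial i (\<lambda>x. f x - g x) = (\<lambda>x. partial i f x - partial i g x)" for i
    by (intro ext partial_diff C2c_differentiable f g)
  then show "grad (\<lambda>x. f x - g x) x = grad f x - grad g x"
    by (simp add: grad_def vec_eq_iff)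
  have pp: "partial j (\<lambda>x. partial i f x - partial i g x) = (\<lambda>x. partial j (partial i f) x - partial j (partial i g) x)" for i j
    by (intro ext partial_diff C2c_partial_differentiable f g)
  obtain B1 where B1: "\<And>x. B1 < norm x \<Longrightarrow> f x = 0"
    using C2c_support[OF f] by metis
  obtain B2 where B2: "\<And>x. B2 < norm x \<Longrightarrow> g x = 0"
    using C2c_support[OF g] by metis
  have "\<forall>x. max B1 B2 < norm x \<longrightarrow> f x - g x = 0"
    using B1 B2 by auto
  then show "(\<lambda>x. f x - g x) \<in> C2c"
    unfolding C2c_def p pp mem_Collect_eq
    by (intro conjI allI exI[of _ "max B1 B2"] differentiable_diff continuous_on_diff
        C2c_differentiable C2c_partial_differentiable C2c_partial_partial_continuous f g) blast+
qed

lemma has_derivative_compose_linear: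
  fixes R :: "real^'n::finite \<Rightarrow> real^'n"
  assumes R: "linear R" and f: "f differentiable (at (R x))"
  shows "((\<lambda>x. f (R x)) has_derivative (\<lambda>h. grad f (R x) \<bullet> R h)) (at x)"
proof -
  have "(R has_derivative R) (at x)"
    using R by (rule linear_imp_has_derivative)
  from diff_chain_at[OF this has_derivative_grad[OF f]] show ?thesis
    by (simp add: o_def)
qed

lemma partial_compose_linear:
  fixes R :: "real^'n::finite \<Rightarrow> real^'n"
  assumes "linear R" and "f differentiable (at (R x))"
  shows "partial i (\<lambda>x. f (R x)) x = (\<Sum>j\<in>UNIV. partial j f (R x) * R (axis i 1) $ j)"
  using partial_eqI[OF has_derivative_compose_linear[OF assms]]
  by (simp add: grad_def inner_vec_def)

text \<open>The chain rule gives the derivative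
  \<open>h \<mapsto> grad f (R x) \<bullet> R h\<close>, and the adjoint moves \<open>R\<close> to
  the other side. Bounded support survives because \<open>R\<close> preserves the norm.\<close>

lemma C2c_compose_orthogonal:
  fixes R :: "real^'n::finite \<Rightarrow> real^'n"
  assumes f: "f \<in> C2c" and R: "orthogonal_transformation R"
  shows "(\<lambda>x. f (R x)) \<in> C2c" and "grad (\<lambda>x. f (R x)) x = adjoint R (grad f (R x))"
proof -
  have lin: "linear R" and norm: "\<And>x. norm (R x) = norm x"
    using R by (auto simp: orthogonal_transformation_linear orthogonal_transformation_norm)
  have cont: "continuous_on UNIV R"
    using lin by (simp add: linear_continuous_on linear_conv_bounded_linear)
  have diffR: "R differentiable (at x)" for x
    using linear_imp_differentiable[OF lin] .
  have comp: "(\<lambda>x. g (R x)) differentiable (at x)" if "\<And>x. g differentiable (at x)" for g :: "real^'n \<Rightarrow> real" and x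
    using differentiable_chain_at[OF diffR that] by (simp add: o_def)
  have p: "partial i (\<lambda>x. f (R x)) = (\<lambda>x. \<Sum>j\<in>UNIV. partial j f (R x) * R (axis i 1) $ j)" for i
    by (intro ext partial_compose_linear lin C2c_differentiable f)
  have dp: "(\<lambda>x. \<Sum>j\<in>UNIV. partial j f (R x) * c j) differentiable (at x)" for c x
  proof -
    have "(\<lambda>x. partial j f (R x)) differentiable (at x)" for j
      by (rule comp) (rule C2c_partial_differentiable[OF f])
    then show ?thesis
      by (intro differentiable_sum differentiable_mult differentiable_const) auto
  qed
  have pp: "partial l (\<lambda>x. \<Sum>j\<in>UNIV. partial j f (R x) * c j)
      = (\<lambda>x. \<Sum>j\<in>UNIV. (grad (partial j f) (R x) \<bullet> R (axis l 1)) * c j)" for c l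
  proof (rule ext)
    fix x
    have "((\<lambda>x. \<Sum>j\<in>UNIV. partial j f (R x) * c j) has_derivative
        (\<lambda>h. \<Sum>j\<in>UNIV. (grad (partial j f) (R x) \<bullet> R h) * c j)) (at x)"
      by (intro has_derivative_sum has_derivative_mult_left has_derivative_compose_linear lin
          C2c_partial_differentiable f)
    from partial_eqI[OF this]
    show "partial l (\<lambda>x. \<Sum>j\<in>UNIV. partial j f (R x) * c j) x
      = (\<Sum>j\<in>UNIV. (grad (partial j f) (R x) \<bullet> R (axis l 1)) * c j)" .
  qed
  have gc: "continuous_on UNIV (\<lambda>x. grad (partial j f) (R x))" for j
  proof (rule continuous_on_compose2[OF _ cont])
    show "continuous_on UNIV (grad (partial j f))"
      unfolding grad_def by (intro continuous_on_vec_lambda)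
        (simp add: eta_contract_eq C2c_partial_partial_continuous[OF f])
  qed auto
  obtain B where B: "\<And>x. B < norm x \<Longrightarrow> f x = 0"
    using C2c_support[OF f] by metis
  show "(\<lambda>x. f (R x)) \<in> C2c"
    unfolding C2c_def p pp mem_Collect_eq
    by (intro conjI allI exI[of _ B] comp C2c_differentiable f dp continuous_intros gc)
      (simp add: B norm)
  show "grad (\<lambda>x. f (R x)) x = adjoint R (grad f (R x))"
    using has_derivative_compose_linear[OF lin C2c_differentiable[OF f]]
    by (intro grad_eqI) (simp add: adjoint_clauses(2)[OF lin])
qed

text \<open>Green's identity: the divergence of \<open>f \<nabla>g\<close> integrates to zero, one
  coordinate at a time.\<close>

lemma integral_grad_inner_grad:
  fixes f g :: "real^'n::finite \<Rightarrow> real"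
  assumes f: "f \<in> C2c" and g: "g \<in> C2c"
  shows "(LINT x|lebesgue. grad f x \<bullet> grad g x)
    = - (LINT x|lebesgue. f x * (\<Sum>i\<in>UNIV. partial i (partial i g) x))"
proof -
  obtain B where B: "\<And>x. B < norm x \<Longrightarrow> f x = 0" "\<And>x i. B < norm x \<Longrightarrow> partial i f x = 0"
    using C2c_support[OF f] by metis
  have p: "partial i (\<lambda>x. f x * partial i g x) = (\<lambda>x. partial i f x * partial i g x + f x * partial i (partial i g) x)" for i
    by (intro ext partial_mult C2c_differentiable C2c_partial_differentiable f g)
  note conts = continuous_on_mult continuous_on_add C2c_continuous C2c_partial_continuous
    C2c_partial_partial_continuous f g
  have int: "integrable lebesgue (\<lambda>x. partial i f x * partial i g x)"
    "integrable lebesgue (\<lambda>x. f x * partial i (partial i g) x)" for i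
    by (rule integrable_lebesgue_continuous_bounded_support[where B = B], intro conts, simp add: B)+
  have eq: "(LINT x|lebesgue. partial i f x * partial i g x) = - (LINT x|lebesgue. f x * partial i (partial i g) x)" for i
  proof -
    have "(LINT x|lebesgue. partial i (\<lambda>x. f x * partial i g x) x) = 0"
    proof (rule integral_partial_eq_0)
      show "continuous_on UNIV (partial i (\<lambda>x. f x * partial i g x))"
        unfolding p by (intro conts)
      show "(\<lambda>x. f x * partial i g x) differentiable (at x)" for x
        by (intro differentiable_mult C2c_differentiable[OF f] C2c_partial_differentiable[OF g])
      show "f x * partial i g x = 0" if "B < norm x" for x
        using B(1)[OF that] by simp
    qed
    then show ?thesis
      using int[of i] by (simp add: p)
  qed
  have "(LINT x|lebesgue. grad f x \<bullet> grad g x) = (\<Sum>i\<in>UNIV. LINT x|lebesgue. partial i f x * partial i g x)"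
    using int by (simp add: inner_vec_def grad_def)
  also have "\<dots> = - (\<Sum>i\<in>UNIV. LINT x|lebesgue. f x * partial i (partial i g) x)"
    by (simp add: eq sum_negf)
  also have "\<dots> = - (LINT x|lebesgue. f x * (\<Sum>i\<in>UNIV. partial i (partial i g) x))"
    using int by (simp add: sum_distrib_left)
  finally show ?thesis .
qed

lemma square_integrable_grad:
  assumes f: "f \<in> C2c"
  shows "square_integrable lebesgue (grad f)"
proof -
  obtain B where B: "\<And>x. B < norm x \<Longrightarrow> grad f x = 0"
    using C2c_support[OF f] by metis
  have "integrable lebesgue (grad f)"
    using C2c_grad_continuous[OF f] B by (rule integrable_lebesgue_continuous_bounded_support)
  moreover have "integrable lebesgue (\<lambda>x. (norm (grad f x))\<^sup>2)"
    by (rule integrable_lebesgue_continuous_bounded_support[where B = B])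
      (auto intro!: continuous_intros C2c_grad_continuous f simp: B)
  ultimately show ?thesis by (simp add: square_integrable_def)
qed

section \<open>The gradient on the completion\<close>

text \<open>The pair \<open>(v, G)\<close> is a limit of pairs \<open>(\<phi>, \<nabla>\<phi>)\<close>: \<open>G\<close> is the gradient of \<open>v\<close> without reference to weak derivatives.\<close>

definition H1_pair :: "(real^'n::finite \<Rightarrow> real) \<Rightarrow> (real^'n \<Rightarrow> real^'n) \<Rightarrow> bool" where
  "H1_pair v G \<longleftrightarrow> v \<in> borel_measurable lebesgue \<and> integrable lebesgue (\<lambda>x. \<bar>v x\<bar> ^ 6) \<and>
     square_integrable lebesgue G \<and>
     (\<exists>\<phi>. (\<forall>n. \<phi> n \<in> C2c) \<and>
       (\<lambda>n. LINT x|lebesgue. \<bar>\<phi> n x - v x\<bar> ^ 6) \<longlonglongrightarrow> 0 \<and>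
       (\<lambda>n. LINT x|lebesgue. (norm (grad (\<phi> n) x - G x))\<^sup>2) \<longlonglongrightarrow> 0)"

text \<open>The difference is at most twice the larger absolute value, and 64 is the sixth power of
  2.\<close>

lemma abs_diff_power6_le:
  fixes a b :: real
  shows "\<bar>a - b\<bar> ^ 6 \<le> 64 * \<bar>a\<bar> ^ 6 + 64 * \<bar>b\<bar> ^ 6"
proof -
  have "\<bar>a - b\<bar> ^ 6 \<le> (2 * max \<bar>a\<bar> \<bar>b\<bar>) ^ 6"
    by (intro power_mono) (auto simp: max_def)
  also have "\<dots> \<le> 64 * \<bar>a\<bar> ^ 6 + 64 * \<bar>b\<bar> ^ 6"
    by (auto simp: power_mult_distrib max_def)
  finally show ?thesis .
qed

lemma integrable_power6_diff:
  fixes f g :: "'a \<Rightarrow> real"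
  assumes [measurable]: "f \<in> borel_measurable M" "g \<in> borel_measurable M"
    and f: "integrable M (\<lambda>x. \<bar>f x\<bar> ^ 6)" and g: "integrable M (\<lambda>x. \<bar>g x\<bar> ^ 6)"
  shows "integrable M (\<lambda>x. \<bar>f x - g x\<bar> ^ 6)"
proof (rule Bochner_Integration.integrable_bound)
  show "integrable M (\<lambda>x. 64 * \<bar>f x\<bar> ^ 6 + 64 * \<bar>g x\<bar> ^ 6)"
    using f g by simp
  show "AE x in M. norm (\<bar>f x - g x\<bar> ^ 6) \<le> norm (64 * \<bar>f x\<bar> ^ 6 + 64 * \<bar>g x\<bar> ^ 6)"
    using abs_diff_power6_le by (intro AE_I2) (simp add: power_abs)
qed measurable

lemma borel_measurable_lebesgue_continuous:
  "continuous_on UNIV f \<Longrightarrow> f \<in> borel_measurable lebesgue"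
  by (rule measurable_completion) (simp add: borel_measurable_continuous_onI)

lemma C2c_measurable: "f \<in> C2c \<Longrightarrow> f \<in> borel_measurable lebesgue"
  by (rule borel_measurable_lebesgue_continuous) (rule C2c_continuous)

lemma C2c_integrable_power6:
  assumes f: "f \<in> C2c"
  shows "integrable lebesgue (\<lambda>x. \<bar>f x\<bar> ^ 6)"
proof -
  obtain B where "\<And>x. B < norm x \<Longrightarrow> f x = 0"
    using C2c_support[OF f] by metis
  then show ?thesis
    by (intro integrable_lebesgue_continuous_bounded_support[where B = B])
      (auto intro!: continuous_intros C2c_continuous[OF f])
qed

text \<open>Its purpose is to reduce the comparison of two gradients to the gradient of a function
  that vanishes almost everywhere.\<close>

lemma H1_pair_diff:
  assumes v: "H1_pair v G" and w: "H1_pair w H"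
  shows "H1_pair (\<lambda>x. v x - w x) (\<lambda>x. G x - H x)"
proof -
  obtain \<phi> where \<phi>: "\<And>n. \<phi> n \<in> C2c" "(\<lambda>n. LINT x|lebesgue. \<bar>\<phi> n x - v x\<bar> ^ 6) \<longlonglongrightarrow> 0"
      "(\<lambda>n. LINT x|lebesgue. (norm (grad (\<phi> n) x - G x))\<^sup>2) \<longlonglongrightarrow> 0"
    using v by (auto simp: H1_pair_def)
  obtain \<psi> where \<psi>: "\<And>n. \<psi> n \<in> C2c" "(\<lambda>n. LINT x|lebesgue. \<bar>\<psi> n x - w x\<bar> ^ 6) \<longlonglongrightarrow> 0"
      "(\<lambda>n. LINT x|lebesgue. (norm (grad (\<psi> n) x - H x))\<^sup>2) \<longlonglongrightarrow> 0"
    using w by (auto simp: H1_pair_def)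
  have v': "v \<in> borel_measurable lebesgue" "integrable lebesgue (\<lambda>x. \<bar>v x\<bar> ^ 6)" "square_integrable lebesgue G"
    and w': "w \<in> borel_measurable lebesgue" "integrable lebesgue (\<lambda>x. \<bar>w x\<bar> ^ 6)" "square_integrable lebesgue H"
    using v w by (auto simp: H1_pair_def)
  have i6: "integrable lebesgue (\<lambda>x. \<bar>\<phi> n x - v x\<bar> ^ 6)" "integrable lebesgue (\<lambda>x. \<bar>\<psi> n x - w x\<bar> ^ 6)" for n
    by (intro integrable_power6_diff C2c_measurable C2c_integrable_power6 \<phi> \<psi> v' w')+
  have m6: "(\<lambda>x. \<phi> n x - v x) \<in> borel_measurable lebesgue" "(\<lambda>x. \<psi> n x - w x) \<in> borel_measurable lebesgue" for n
    by (intro borel_measurable_diff C2c_measurable \<phi> \<psi> v' w')+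
  have s2: "square_integrable lebesgue (\<lambda>x. grad (\<phi> n) x - G x)" "square_integrable lebesgue (\<lambda>x. grad (\<psi> n) x - H x)" for n
    by (intro square_integrable_diff square_integrable_grad \<phi> \<psi> v' w')+
  have "(\<lambda>n. LINT x|lebesgue. \<bar>(\<phi> n x - \<psi> n x) - (v x - w x)\<bar> ^ 6) \<longlonglongrightarrow> 0"
  proof (rule tendsto_sandwich[OF _ _ tendsto_const])
    show "\<forall>\<^sub>F n in sequentially. (LINT x|lebesgue. \<bar>(\<phi> n x - \<psi> n x) - (v x - w x)\<bar> ^ 6)
      \<le> 64 * (LINT x|lebesgue. \<bar>\<phi> n x - v x\<bar> ^ 6) + 64 * (LINT x|lebesgue. \<bar>\<psi> n x - w x\<bar> ^ 6)"
    proof (intro always_eventually allI)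
      fix n
      have "(LINT x|lebesgue. \<bar>(\<phi> n x - v x) - (\<psi> n x - w x)\<bar> ^ 6)
        \<le> (LINT x|lebesgue. 64 * \<bar>\<phi> n x - v x\<bar> ^ 6 + 64 * \<bar>\<psi> n x - w x\<bar> ^ 6)"
        by (intro integral_mono integrable_power6_diff m6 i6 Bochner_Integration.integrable_add
            integrable_mult_right abs_diff_power6_le)
      then show "(LINT x|lebesgue. \<bar>(\<phi> n x - \<psi> n x) - (v x - w x)\<bar> ^ 6)
        \<le> 64 * (LINT x|lebesgue. \<bar>\<phi> n x - v x\<bar> ^ 6) + 64 * (LINT x|lebesgue. \<bar>\<psi> n x - w x\<bar> ^ 6)"
        using i6[of n] by (simp add: algebra_simps)
    qed
    show "(\<lambda>n. 64 * (LINT x|lebesgue. \<bar>\<phi> n x - v x\<bar> ^ 6) + 64 * (LINT x|lebesgue. \<bar>\<psi> n x - w x\<bar> ^ 6)) \<longlonglongrightarrow> 0"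
      using tendsto_add[OF tendsto_mult_left[OF \<phi>(2), of 64] tendsto_mult_left[OF \<psi>(2), of 64]] by simp
  qed simp
  moreover have "(\<lambda>n. LINT x|lebesgue. (norm (grad (\<lambda>x. \<phi> n x - \<psi> n x) x - (G x - H x)))\<^sup>2) \<longlonglongrightarrow> 0"
  proof (rule tendsto_sandwich[OF _ _ tendsto_const])
    show "\<forall>\<^sub>F n in sequentially. (LINT x|lebesgue. (norm (grad (\<lambda>x. \<phi> n x - \<psi> n x) x - (G x - H x)))\<^sup>2)
      \<le> 2 * (LINT x|lebesgue. (norm (grad (\<phi> n) x - G x))\<^sup>2) + 2 * (LINT x|lebesgue. (norm (grad (\<psi> n) x - H x))\<^sup>2)"
    proof (intro always_eventually allI)
      fix n
      let ?p = "\<lambda>x. grad (\<phi> n) x - G x" and ?q = "\<lambda>x. grad (\<psi> n) x - H x"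
      have "(LINT x|lebesgue. (norm (?p x - ?q x))\<^sup>2) \<le> (LINT x|lebesgue. 2 * (norm (?p x))\<^sup>2 + 2 * (norm (?q x))\<^sup>2)"
      proof (rule integral_mono)
        show "integrable lebesgue (\<lambda>x. (norm (?p x - ?q x))\<^sup>2)"
          using square_integrable_diff[OF s2(1) s2(2)] by (simp add: square_integrable_def)
        show "integrable lebesgue (\<lambda>x. 2 * (norm (?p x))\<^sup>2 + 2 * (norm (?q x))\<^sup>2)"
          using s2 by (simp add: square_integrable_def)
        show "(norm (?p x - ?q x))\<^sup>2 \<le> 2 * (norm (?p x))\<^sup>2 + 2 * (norm (?q x))\<^sup>2" for x
          by (rule norm_diff_square_le)
      qed
      also have "\<dots> = 2 * (LINT x|lebesgue. (norm (?p x))\<^sup>2) + 2 * (LINT x|lebesgue. (norm (?q x))\<^sup>2)"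
        using s2 by (simp add: square_integrable_def)
      finally show "(LINT x|lebesgue. (norm (grad (\<lambda>x. \<phi> n x - \<psi> n x) x - (G x - H x)))\<^sup>2)
        \<le> 2 * (LINT x|lebesgue. (norm (?p x))\<^sup>2) + 2 * (LINT x|lebesgue. (norm (?q x))\<^sup>2)"
        by (simp add: C2c_diff(2)[OF \<phi>(1) \<psi>(1)] algebra_simps)
    qed
    show "(\<lambda>n. 2 * (LINT x|lebesgue. (norm (grad (\<phi> n) x - G x))\<^sup>2) + 2 * (LINT x|lebesgue. (norm (grad (\<psi> n) x - H x))\<^sup>2)) \<longlonglongrightarrow> 0"
      using tendsto_add[OF tendsto_mult_left[OF \<phi>(3), of 2] tendsto_mult_left[OF \<psi>(3), of 2]] by simp
  qed simp
  ultimately show ?thesis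
    unfolding H1_pair_def
    by (intro conjI exI[of _ "\<lambda>n x. \<phi> n x - \<psi> n x"] allI C2c_diff(1)[OF \<phi>(1) \<psi>(1)]
        borel_measurable_diff integrable_power6_diff square_integrable_diff v' w')
qed

text \<open>The adjoint of an orthogonal map is its inverse.\<close>

lemma norm_adjoint_orthogonal:
  fixes R :: "'a::euclidean_space \<Rightarrow> 'a"
  assumes R: "orthogonal_transformation R"
  shows "norm (adjoint R y) = norm y"
proof -
  obtain x where x: "y = R x"
    using orthogonal_transformation_surj[OF R] by (auto simp: surj_def)
  have "adjoint R (R x) = x"
  proof (rule vector_eq_ldot[THEN iffD1], rule allI)
    fix z show "z \<bullet> adjoint R (R x) = z \<bullet> x"
      using R by (simp add: adjoint_works[OF orthogonal_transformation_linear[OF R]] orthogonal_transformation_def)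
  qed
  then show ?thesis
    using x orthogonal_transformation_norm[OF R] by simp
qed

text \<open>Composing the approximants with \<open>R\<close> changes neither distance: the integrals
  are invariant under the substitution, and \<open>adjoint R\<close> is an isometry on
  gradients.\<close>

lemma H1_pair_compose_orthogonal:
  fixes v :: "real^'n::{finite,wellorder} \<Rightarrow> real" and R :: "real^'n::_ \<Rightarrow> real^'n::_"
  assumes v: "H1_pair v G" and R: "orthogonal_transformation R"
  shows "H1_pair (\<lambda>x. v (R x)) (\<lambda>x. adjoint R (G (R x)))"
proof -
  obtain \<phi> where \<phi>: "\<And>n. \<phi> n \<in> C2c" "(\<lambda>n. LINT x|lebesgue. \<bar>\<phi> n x - v x\<bar> ^ 6) \<longlonglongrightarrow> 0"
      "(\<lambda>n. LINT x|lebesgue. (norm (grad (\<phi> n) x - G x))\<^sup>2) \<longlonglongrightarrow> 0"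
    using v by (auto simp: H1_pair_def)
  have v': "v \<in> borel_measurable lebesgue" "integrable lebesgue (\<lambda>x. \<bar>v x\<bar> ^ 6)" "square_integrable lebesgue G"
    using v by (auto simp: H1_pair_def)
  have [measurable]: "v \<in> borel_measurable lebesgue" "G \<in> borel_measurable lebesgue"
    "\<And>n. \<phi> n \<in> borel_measurable lebesgue" "\<And>n. grad (\<phi> n) \<in> borel_measurable lebesgue"
    using v' C2c_measurable[OF \<phi>(1)] square_integrable_grad[OF \<phi>(1)] by (auto simp: square_integrable_def)
  have lin: "linear (adjoint R)"
    by (rule adjoint_linear) (rule orthogonal_transformation_linear[OF R])
  have adj: "adjoint R \<in> borel_measurable borel"
    using lin by (intro borel_measurable_continuous_onI linear_continuous_on) (simp add: linear_conv_bounded_linear)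
  have sq: "square_integrable lebesgue (\<lambda>x. adjoint R (G (R x)))"
    using v'(3) measurable_compose[OF borel_measurable_lebesgue_orthogonal[of _ G, OF R] adj]
      integrable_lebesgue_orthogonal[OF R, of "\<lambda>x. (norm (G x))\<^sup>2"]
    by (simp add: square_integrable_def norm_adjoint_orthogonal[OF R])
  have "(LINT x|lebesgue. \<bar>\<phi> n (R x) - v (R x)\<bar> ^ 6) = (LINT x|lebesgue. \<bar>\<phi> n x - v x\<bar> ^ 6)" for n
    by (rule integral_lebesgue_orthogonal[OF R, of "\<lambda>x. \<bar>\<phi> n x - v x\<bar> ^ 6"]) measurable
  moreover have "(LINT x|lebesgue. (norm (grad (\<lambda>x. \<phi> n (R x)) x - adjoint R (G (R x))))\<^sup>2)
      = (LINT x|lebesgue. (norm (grad (\<phi> n) x - G x))\<^sup>2)" for n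
  proof -
    have "(LINT x|lebesgue. (norm (grad (\<lambda>x. \<phi> n (R x)) x - adjoint R (G (R x))))\<^sup>2)
        = (LINT x|lebesgue. (norm (grad (\<phi> n) (R x) - G (R x)))\<^sup>2)"
      unfolding C2c_compose_orthogonal(2)[OF \<phi>(1) R] linear_diff[OF lin, symmetric] norm_adjoint_orthogonal[OF R] ..
    also have "\<dots> = (LINT x|lebesgue. (norm (grad (\<phi> n) x - G x))\<^sup>2)"
      by (rule integral_lebesgue_orthogonal[OF R, of "\<lambda>x. (norm (grad (\<phi> n) x - G x))\<^sup>2"]) measurable
    finally show ?thesis .
  qed
  ultimately have lims: "(\<lambda>n. LINT x|lebesgue. \<bar>\<phi> n (R x) - v (R x)\<bar> ^ 6) \<longlonglongrightarrow> 0"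
    "(\<lambda>n. LINT x|lebesgue. (norm (grad (\<lambda>x. \<phi> n (R x)) x - adjoint R (G (R x))))\<^sup>2) \<longlonglongrightarrow> 0"
    using \<phi>(2,3) by simp_all
  show ?thesis
    unfolding H1_pair_def
    by (intro conjI exI[of _ "\<lambda>n x. \<phi> n (R x)"] allI C2c_compose_orthogonal(1)[OF \<phi>(1) R] sq lims
        borel_measurable_lebesgue_orthogonal[OF R v'(1)] integrable_lebesgue_orthogonal[OF R v'(2)])
qed

text \<open>Either \<open>x \<le> e\<close>, or \<open>x / e\<close> exceeds 1 and its powers may be
  multiplied in. With exponents \<open>1 + 5\<close> and \<open>2 + 4\<close> this controls first
  and second powers on sets of finite measure by the sixth power.\<close>

lemma le_add_power_div:
  fixes x e :: real
  assumes "0 \<le> x" "0 < e"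
  shows "x ^ k \<le> e ^ k + x ^ (k + m) / e ^ m"
proof (cases "x \<le> e")
  case True
  have "x ^ k \<le> e ^ k" by (rule power_mono[OF True assms(1)])
  moreover have "0 \<le> x ^ (k + m) / e ^ m"
    using assms by (intro divide_nonneg_nonneg zero_le_power) simp_all
  ultimately show ?thesis by (rule add_increasing2[rotated])
next
  case False
  then have "e ^ m \<le> x ^ m" using assms(2) by (intro power_mono) simp_all
  then have "x ^ k * e ^ m \<le> x ^ k * x ^ m" by (rule mult_left_mono) (simp add: assms(1))
  also have "\<dots> = x ^ (k + m)" by (rule power_add[symmetric])
  finally have "x ^ k \<le> x ^ (k + m) / e ^ m"
    by (rule pos_le_divide_eq[THEN iffD2, rotated]) (simp add: assms(2))
  moreover have "0 \<le> e ^ k"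
    using assms(2) by (intro zero_le_power) simp
  ultimately show ?thesis by (rule add_increasing[rotated])
qed

text \<open>The gradient is a closed operator: if \<open>\<psi>\<^sub>n \<rightarrow> 0\<close> and \<open>\<nabla>\<psi>\<^sub>n \<rightarrow> G\<close>, then \<open>\<integral>G \<bullet> \<nabla>\<psi>\<^sub>m = - lim\<^sub>n \<integral>\<psi>\<^sub>n \<Delta>\<psi>\<^sub>m = 0\<close>,
  and \<open>m \<rightarrow> \<infinity>\<close> gives \<open>\<integral>|G|\<^sup>2 = 0\<close>.\<close>

lemma H1_pair_zero:
  assumes pair: "H1_pair v G" and v: "AE x in lebesgue. v x = 0"
  shows "AE x in lebesgue. G x = 0"
proof -
  obtain \<psi> where \<psi>: "\<And>n. \<psi> n \<in> C2c" "(\<lambda>n. LINT x|lebesgue. \<bar>\<psi> n x - v x\<bar> ^ 6) \<longlonglongrightarrow> 0"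
      "(\<lambda>n. LINT x|lebesgue. (norm (grad (\<psi> n) x - G x))\<^sup>2) \<longlonglongrightarrow> 0"
    using pair by (auto simp: H1_pair_def)
  have G: "square_integrable lebesgue G" and [measurable]: "v \<in> borel_measurable lebesgue"
    using pair by (auto simp: H1_pair_def)
  have [measurable]: "\<psi> n \<in> borel_measurable lebesgue" for n
    using C2c_measurable[OF \<psi>(1)] .
  have "(LINT x|lebesgue. \<bar>\<psi> n x - v x\<bar> ^ 6) = (LINT x|lebesgue. \<bar>\<psi> n x\<bar> ^ 6)" for n
    using v by (intro integral_cong_AE) auto
  with \<psi>(2) have lim6: "(\<lambda>n. LINT x|lebesgue. \<bar>\<psi> n x\<bar> ^ 6) \<longlonglongrightarrow> 0"
    by simp
  have orth: "(LINT x|lebesgue. G x \<bullet> grad (\<psi> m) x) = 0" for m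
  proof -
    \<comment> \<open>The Laplacian of \<open>\<psi> m\<close> is a fixed continuous function of
      bounded support, so convergence of \<open>\<psi> n\<close> in \<open>L^6\<close> suffices to
      make their pairing tend to 0.\<close>
    define L where "L x = (\<Sum>i\<in>UNIV. partial i (partial i (\<psi> m)) x)" for x
    obtain B where B: "\<And>x. B < norm x \<Longrightarrow> L x = 0"
      unfolding L_def using C2c_support[OF \<psi>(1)] by (metis (no_types, lifting) sum.neutral)
    have L_cont: "continuous_on UNIV L"
      unfolding L_def by (intro continuous_on_sum C2c_partial_partial_continuous \<psi>)
    then have L_meas [measurable]: "L \<in> borel_measurable lebesgue"
      by (rule borel_measurable_lebesgue_continuous)
    have "bounded (L ` cball 0 B)"
      using L_cont by (intro compact_imp_bounded compact_continuous_image) (auto intro: continuous_on_subset)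
    then obtain C where C: "0 < C" "\<And>x. norm x \<le> B \<Longrightarrow> \<bar>L x\<bar> \<le> C"
      unfolding bounded_pos by auto
    let ?V = "measure lebesgue (cball (0::real^'a) B)"
    have "(\<lambda>n. LINT x|lebesgue. \<psi> n x * L x) \<longlonglongrightarrow> 0"
    proof (rule tendsto_0_of_weighted_bound[OF lim6])
      fix e :: real assume e: "0 < e"
      \<comment> \<open>Threshold for the size of \<open>\<psi> n x\<close>: values below
        \<open>s\<close> contribute at most \<open>e\<close>, since \<open>L\<close> is bounded by
        \<open>C\<close> and vanishes outside a ball of measure \<open>?V\<close>; larger values are
        charged to the sixth power.\<close>
      define s where "s = e / (C * ?V + 1)"
      have s: "0 < s" "s * (C * ?V) \<le> e"
      proof -
        have V: "0 \<le> C * ?V" using C(1) by simp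
        then show "0 < s" using e by (simp add: s_def add_nonneg_pos)
        have "e * (C * ?V) \<le> e * (C * ?V + 1)" using e by (intro mult_left_mono) auto
        then show "s * (C * ?V) \<le> e"
          using V by (simp add: s_def pos_divide_le_eq add_nonneg_pos)
      qed
      have "\<bar>LINT x|lebesgue. \<psi> n x * L x\<bar> \<le> e + C / s ^ 5 * (LINT x|lebesgue. \<bar>\<psi> n x\<bar> ^ 6)" for n
      proof -
        have i1: "integrable lebesgue (\<lambda>x. \<psi> n x * L x)"
          by (rule integrable_lebesgue_continuous_bounded_support[where B = B])
            (auto intro!: continuous_on_mult C2c_continuous[OF \<psi>(1)] L_cont simp: B)
        have i2: "integrable lebesgue (\<lambda>x. \<bar>\<psi> n x\<bar> ^ 6)"
          by (rule C2c_integrable_power6[OF \<psi>(1)])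
        have i3: "integrable lebesgue (indicator (cball 0 B) :: real^'a \<Rightarrow> real)"
          by (simp add: lmeasurable_iff_integrable[symmetric])
        have "\<bar>LINT x|lebesgue. \<psi> n x * L x\<bar> \<le> (LINT x|lebesgue. \<bar>\<psi> n x * L x\<bar>)"
          by (rule integral_abs_bound)
        also have "\<dots> \<le> (LINT x|lebesgue. C * s * indicator (cball 0 B) x + C / s ^ 5 * \<bar>\<psi> n x\<bar> ^ 6)"
        proof (rule integral_mono)
          fix x :: "real^'a"
          have x: "\<bar>\<psi> n x\<bar> \<le> s + \<bar>\<psi> n x\<bar> ^ 6 / s ^ 5"
            using le_add_power_div[OF abs_ge_zero s(1), of "\<psi> n x" 1 5] by simp
          have eq: "(s + u / t) * C = C * s + C * u / t" for u t
            unfolding distrib_right by (simp add: mult.commute)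
          show "\<bar>\<psi> n x * L x\<bar> \<le> C * s * indicator (cball 0 B) x + C / s ^ 5 * \<bar>\<psi> n x\<bar> ^ 6"
          proof (cases "norm x \<le> B")
            case True
            have "\<bar>\<psi> n x\<bar> * \<bar>L x\<bar> \<le> (s + \<bar>\<psi> n x\<bar> ^ 6 / s ^ 5) * C"
              by (rule mult_mono[OF x C(2)[OF True]]) (use s(1) in simp_all)
            also have "\<dots> = C * s * indicator (cball 0 B) x + C / s ^ 5 * \<bar>\<psi> n x\<bar> ^ 6"
              using True by (simp add: eq)
            finally show ?thesis by (simp only: abs_mult)
          next
            case False
            then have "L x = 0" "indicator (cball 0 B) x = (0::real)"
              by (auto intro: B)
            moreover have "0 \<le> C / s ^ 5 * \<bar>\<psi> n x\<bar> ^ 6"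
              using C(1) s(1) by (intro mult_nonneg_nonneg divide_nonneg_nonneg zero_le_power) auto
            ultimately show ?thesis by (simp only: mult_zero_right abs_zero add_0_left)
          qed
          show "integrable lebesgue (\<lambda>x. \<bar>\<psi> n x * L x\<bar>)"
            by (rule integrable_abs[OF i1])
          show "integrable lebesgue (\<lambda>x. C * s * indicator (cball 0 B) x + C / s ^ 5 * \<bar>\<psi> n x\<bar> ^ 6)"
            by (rule Bochner_Integration.integrable_add[OF integrable_mult_right[OF i3] integrable_mult_right[OF i2]])
        qed
        also have "\<dots> = C * s * ?V + C / s ^ 5 * (LINT x|lebesgue. \<bar>\<psi> n x\<bar> ^ 6)"
          unfolding Bochner_Integration.integral_add[OF integrable_mult_right[OF i3] integrable_mult_right[OF i2]]
          by simp
        finally have "\<bar>LINT x|lebesgue. \<psi> n x * L x\<bar> \<le> C * s * ?V + C / s ^ 5 * (LINT x|lebesgue. \<bar>\<psi> n x\<bar> ^ 6)" .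
        moreover have "C * s * ?V \<le> e"
          using s(2) by (simp only: mult_ac)
        ultimately show ?thesis
          by (rule order_trans[OF _ add_right_mono])
      qed
      then show "\<exists>K. \<forall>n. \<bar>LINT x|lebesgue. \<psi> n x * L x\<bar> \<le> e + K * (LINT x|lebesgue. \<bar>\<psi> n x\<bar> ^ 6)"
        by blast
    qed
    from tendsto_minus[OF this]
    have "(\<lambda>n. LINT x|lebesgue. grad (\<psi> n) x \<bullet> grad (\<psi> m) x) \<longlonglongrightarrow> 0"
      by (simp add: integral_grad_inner_grad[OF \<psi>(1) \<psi>(1)] L_def)
    moreover have "(\<lambda>n. LINT x|lebesgue. grad (\<psi> n) x \<bullet> grad (\<psi> m) x) \<longlonglongrightarrow> (LINT x|lebesgue. G x \<bullet> grad (\<psi> m) x)"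
      by (rule integral_inner_tendsto[OF square_integrable_grad[OF \<psi>(1)] G square_integrable_grad[OF \<psi>(1)] \<psi>(3)])
    ultimately show ?thesis
      by (rule LIMSEQ_unique[symmetric])
  qed
  have "(\<lambda>m. LINT x|lebesgue. grad (\<psi> m) x \<bullet> G x) \<longlonglongrightarrow> (LINT x|lebesgue. G x \<bullet> G x)"
    by (rule integral_inner_tendsto[OF square_integrable_grad[OF \<psi>(1)] G G \<psi>(3)])
  moreover have "(\<lambda>m. LINT x|lebesgue. grad (\<psi> m) x \<bullet> G x) = (\<lambda>m. 0)"
    using orth unfolding inner_commute[of "G _"] by (rule ext)
  ultimately have "(\<lambda>m::nat. 0) \<longlonglongrightarrow> (LINT x|lebesgue. G x \<bullet> G x)"
    by (rule back_subst[where P = "\<lambda>f. f \<longlonglongrightarrow> _"])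
  then have "(LINT x|lebesgue. G x \<bullet> G x) = 0"
    by (rule LIMSEQ_unique) (rule tendsto_const)
  then have "(LINT x|lebesgue. (norm (G x))\<^sup>2) = 0"
    by (simp only: power2_norm_eq_inner)
  then have "AE x in lebesgue. (norm (G x))\<^sup>2 = 0"
    using G unfolding square_integrable_def by (subst (asm) integral_nonneg_eq_0_iff_AE) simp_all
  then show ?thesis by simp
qed

text \<open>The difference of \<open>v \<circ> R\<close> and \<open>v\<close> is null, so its
  gradient \<open>adjoint R (G (R x)) - G x\<close> is null by closedness, and
  \<open>adjoint R\<close> preserves norms.\<close>

corollary H1_pair_orthogonal_invariant:
  fixes v :: "real^'n::{finite,wellorder} \<Rightarrow> real" and R :: "real^'n::_ \<Rightarrow> real^'n::_"
  assumes pair: "H1_pair v G" and R: "orthogonal_transformation R"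
    and v: "AE x in lebesgue. v (R x) = v x"
  shows "AE x in lebesgue. norm (G (R x)) = norm (G x)"
proof -
  have "AE x in lebesgue. adjoint R (G (R x)) - G x = 0"
    using H1_pair_zero[OF H1_pair_diff[OF H1_pair_compose_orthogonal[OF pair R] pair]] v by simp
  then show ?thesis
    by eventually_elim (metis norm_adjoint_orthogonal[OF R] right_minus_eq)
qed

section \<open>A superharmonic weight\<close>

text \<open>Integrate the divergence of \<open>- \<phi>\<^sup>2 \<nabla>W / W\<close> and complete
  the square. The potential enters only through \<open>V x * W x \<le> - \<Delta>W\<close>, so it
  may be discontinuous, as a sum of indicators is.\<close>

lemma ground_state_inequality:
  fixes W \<phi> V :: "real^'n::finite \<Rightarrow> real"
  assumes W: "\<And>x. W differentiable (at x)" and W': "\<And>i x. partial i W differentiable (at x)"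
    and W'': "\<And>i. continuous_on UNIV (partial i (partial i W))"
    and pos: "\<And>x. 0 < W x"
    and V: "\<And>x. V x * W x \<le> - (\<Sum>i\<in>UNIV. partial i (partial i W) x)"
    and \<phi>: "\<phi> \<in> C2c" and int: "integrable lebesgue (\<lambda>x. V x * (\<phi> x)\<^sup>2)"
  shows "(LINT x|lebesgue. V x * (\<phi> x)\<^sup>2) \<le> (LINT x|lebesgue. (norm (grad \<phi> x))\<^sup>2)"
proof -
  obtain B where B: "\<And>x. B < norm x \<Longrightarrow> \<phi> x = 0" "\<And>x i. B < norm x \<Longrightarrow> partial i \<phi> x = 0"
    using C2c_support[OF \<phi>] by metis
  \<comment> \<open>\<open>g\<close> is the vector field
    \<open>- \<phi>\<^sup>2 \<nabla>(log W)\<close>, and \<open>g' i\<close> is the derivative of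
    its component \<open>i\<close> in direction \<open>i\<close>.\<close>
  define g where "g i x = - (partial i W x / W x * (\<phi> x)\<^sup>2)" for i x
  define g' where "g' i x = (- partial i (partial i W) x / W x + (partial i W x / W x)\<^sup>2) * (\<phi> x)\<^sup>2
    - 2 * (partial i W x / W x) * \<phi> x * partial i \<phi> x" for i x
  have g_partial: "partial i (g i) = g' i" and g_differentiable: "g i differentiable (at x)" for i x
  proof -
    have der: "(g i has_derivative (\<lambda>h. - (partial i W x / W x * (of_nat 2 * (grad \<phi> x \<bullet> h) * \<phi> x ^ (2 - 1))
        + ((grad (partial i W) x \<bullet> h) * W x - partial i W x * (grad W x \<bullet> h)) / (W x * W x) * (\<phi> x)\<^sup>2))) (at x)" for x
      unfolding g_def
      by (rule has_derivative_minus[OF has_derivative_mult[OF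
            has_derivative_divide'[OF has_derivative_grad[OF W'] has_derivative_grad[OF W] less_imp_neq[OF pos, symmetric]]
            has_derivative_power[OF has_derivative_grad[OF C2c_differentiable[OF \<phi>]]]]])
    then show "g i differentiable (at x)"
      by (rule differentiableI)
    show "partial i (g i) = g' i"
    proof
      fix x
      have alg: "- (b / c * (of_nat 2 * e * d ^ (2 - 1)) + (a * c - b * b) / (c * c) * d\<^sup>2)
          = (- a / c + (b / c)\<^sup>2) * d\<^sup>2 - 2 * (b / c) * d * e" if "c \<noteq> 0" for a b c d e :: real
        using that by (simp add: field_simps power2_eq_square)
      show "partial i (g i) x = g' i x"
        unfolding partial_eqI[OF der] g'_def grad_def inner_axis vec_lambda_beta inner_real_def mult_1_right
        by (rule alg[OF less_imp_neq[OF pos, symmetric]])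
    qed
  qed
  have W_cont: "continuous_on UNIV W" "continuous_on UNIV (partial i W)" for i
    by (rule continuous_on_differentiable W W')+
  have g'_cont: "continuous_on UNIV (g' i)" for i
    unfolding g'_def
    by (intro continuous_intros W_cont W'' C2c_continuous[OF \<phi>] C2c_partial_continuous[OF \<phi>])
      (simp_all add: less_imp_neq[OF pos, symmetric])
  have "(LINT x|lebesgue. partial i (g i) x) = 0" for i
  proof (rule integral_partial_eq_0)
    show "g i differentiable (at x)" for x
      by (rule g_differentiable)
    show "continuous_on UNIV (partial i (g i))"
      unfolding g_partial by (rule g'_cont)
    show "g i x = 0" if "B < norm x" for x
      using B(1)[OF that] by (simp add: g_def)
  qed
  then have g'_int: "(LINT x|lebesgue. g' i x) = 0" for i
    by (simp add: g_partial)
  have g'_integrable: "integrable lebesgue (g' i)" for i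
    by (rule integrable_lebesgue_continuous_bounded_support[OF g'_cont, of B]) (simp add: g'_def B)
  have grad_integrable: "integrable lebesgue (\<lambda>x. (norm (grad \<phi> x))\<^sup>2)"
    using square_integrable_grad[OF \<phi>] by (simp add: square_integrable_def)
  have "(LINT x|lebesgue. V x * (\<phi> x)\<^sup>2) \<le> (LINT x|lebesgue. (norm (grad \<phi> x))\<^sup>2 + (\<Sum>i\<in>UNIV. g' i x))"
  proof (rule integral_mono[OF int])
    show "integrable lebesgue (\<lambda>x. (norm (grad \<phi> x))\<^sup>2 + (\<Sum>i\<in>UNIV. g' i x))"
      using g'_integrable grad_integrable by simp
    fix x
    have "V x \<le> - (\<Sum>i\<in>UNIV. partial i (partial i W) x) / W x"
      using V[of x] by (simp only: pos_le_divide_eq[OF pos])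
    then have "V x * (\<phi> x)\<^sup>2 \<le> (- (\<Sum>i\<in>UNIV. partial i (partial i W) x) / W x) * (\<phi> x)\<^sup>2"
      by (rule mult_right_mono) simp
    also have "\<dots> = (\<Sum>i\<in>UNIV. - partial i (partial i W) x / W x * (\<phi> x)\<^sup>2)"
      by (simp add: sum_divide_distrib sum_distrib_right sum_negf)
    also have "\<dots> \<le> (\<Sum>i\<in>UNIV. (partial i \<phi> x)\<^sup>2 + g' i x)"
    proof (rule sum_mono)
      fix i
      \<comment> \<open>Expanding this square produces exactly the divergence term
        \<open>g' i x\<close>. Summed over \<open>i\<close>, the square is |grad phi - phi grad W /
        W|^2, the loss in the inequality.\<close>
      have "0 \<le> (partial i \<phi> x - partial i W x / W x * \<phi> x)\<^sup>2" by simp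
      also have "\<dots> = (partial i \<phi> x)\<^sup>2 + g' i x - (- partial i (partial i W) x / W x * (\<phi> x)\<^sup>2)"
        by (simp add: g'_def power2_eq_square algebra_simps)
      finally show "- partial i (partial i W) x / W x * (\<phi> x)\<^sup>2 \<le> (partial i \<phi> x)\<^sup>2 + g' i x"
        by simp
    qed
    also have "\<dots> = (norm (grad \<phi> x))\<^sup>2 + (\<Sum>i\<in>UNIV. g' i x)"
      unfolding sum.distrib power2_norm_eq_inner inner_vec_def grad_def by (simp add: power2_eq_square)
    finally show "V x * (\<phi> x)\<^sup>2 \<le> (norm (grad \<phi> x))\<^sup>2 + (\<Sum>i\<in>UNIV. g' i x)" .
  qed
  also have "\<dots> = (LINT x|lebesgue. (norm (grad \<phi> x))\<^sup>2)"
    using g'_integrable grad_integrable by (simp add: g'_int)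
  finally show ?thesis .
qed

text \<open>In dimension three this is the Aubin-Talenti extremal of the Sobolev inequality,
  concentrated at \<open>p\<close> on scale \<open>\<rho>\<close> and normalized to the value 1 at
  \<open>p\<close>; there it satisfies
  \<open>- \<Delta>u = 3 \<rho>\<^sup>-\<^sup>2 u^5\<close>.\<close>

definition bubble :: "real \<Rightarrow> real^'n::finite \<Rightarrow> real^'n \<Rightarrow> real" where
  "bubble \<rho> p x = \<rho> / sqrt (\<rho>\<^sup>2 + (norm (x - p))\<^sup>2)"

context
  fixes \<rho> :: real and p :: "real^'n::finite"
  assumes \<rho>: "0 < \<rho>"
begin

lemma bubble_denominator_pos: "0 < \<rho>\<^sup>2 + (norm (x - p))\<^sup>2"
  using \<rho> by (simp add: add_pos_nonneg)

lemma bubble_pos: "0 < bubble \<rho> p x"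
  using \<rho> bubble_denominator_pos[of x] by (simp add: bubble_def)

lemma has_derivative_bubble_denominator:
  "((\<lambda>x. sqrt (\<rho>\<^sup>2 + (norm (x - p))\<^sup>2)) has_derivative
    (\<lambda>h. ((x - p) \<bullet> h) / sqrt (\<rho>\<^sup>2 + (norm (x - p))\<^sup>2))) (at x)"
proof -
  have q: "((\<lambda>x. \<rho>\<^sup>2 + (x - p) \<bullet> (x - p)) has_derivative (\<lambda>h. 2 * ((x - p) \<bullet> h))) (at x)"
    by (auto intro!: derivative_eq_intros simp: inner_commute)
  have "0 < \<rho>\<^sup>2 + (x - p) \<bullet> (x - p)"
    using bubble_denominator_pos[of x] by (simp add: power2_norm_eq_inner)
  from has_derivative_real_sqrt[OF this q] show ?thesis
    by (simp add: power2_norm_eq_inner divide_simps)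
qed

lemma bubble_denominator_nonzero: "sqrt (\<rho>\<^sup>2 + (norm (x - p))\<^sup>2) \<noteq> 0"
  using real_sqrt_gt_zero[OF bubble_denominator_pos[of x]] by (rule less_imp_neq[symmetric])

lemma has_derivative_bubble:
  "(bubble \<rho> p has_derivative (\<lambda>h. - \<rho> * ((x - p) \<bullet> h) / sqrt (\<rho>\<^sup>2 + (norm (x - p))\<^sup>2) ^ 3)) (at x)"
proof -
  have alg: "- \<rho> * (inverse s * (d / s) * inverse s) + 0 / s = - \<rho> * d / s ^ 3" if "s \<noteq> 0" for s d
    using that by (simp add: field_simps power3_eq_cube)
  show ?thesis
    unfolding bubble_def
    by (rule has_derivative_eq_rhs[OF has_derivative_divide[OF has_derivative_const
          has_derivative_bubble_denominator bubble_denominator_nonzero]])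
      (rule ext, rule alg[OF bubble_denominator_nonzero])
qed

lemma bubble_differentiable: "bubble \<rho> p differentiable (at x)"
  using has_derivative_bubble by (rule differentiableI)

lemma partial_bubble:
  "partial i (bubble \<rho> p) x = - \<rho> * ((x - p) $ i / sqrt (\<rho>\<^sup>2 + (norm (x - p))\<^sup>2) ^ 3)"
  by (simp add: partial_eqI[OF has_derivative_bubble] inner_axis)

lemma has_derivative_partial_bubble:
  "(partial i (bubble \<rho> p) has_derivative
    (\<lambda>h. - \<rho> * (h $ i / sqrt (\<rho>\<^sup>2 + (norm (x - p))\<^sup>2) ^ 3
      - 3 * (x - p) $ i * ((x - p) \<bullet> h) / sqrt (\<rho>\<^sup>2 + (norm (x - p))\<^sup>2) ^ 5))) (at x)"
proof -
  have comp: "((\<lambda>x. (x - p) $ i) has_derivative (\<lambda>h. h $ i)) (at x)"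
    by (rule has_derivative_eq_rhs[OF bounded_linear.has_derivative[OF bounded_linear_vec_nth
          has_derivative_diff[OF has_derivative_ident has_derivative_const]]]) simp
  have alg: "- \<rho> * (- y * (inverse (s ^ 3) * (of_nat 3 * (d / s) * s ^ (3 - 1)) * inverse (s ^ 3)) + e / s ^ 3)
      = - \<rho> * (e / s ^ 3 - 3 * y * d / s ^ 5)" if "s \<noteq> 0" for y d e s
  proof -
    have "inverse (s ^ 3) * (of_nat 3 * (d / s) * s ^ (3 - 1)) * inverse (s ^ 3) = 3 * d / s ^ 5"
      using that by (simp add: divide_simps flip: power_add power_Suc)
    then show ?thesis by (simp add: algebra_simps)
  qed
  show ?thesis
    unfolding partial_bubble[abs_def]
    by (rule has_derivative_eq_rhs[OF has_derivative_mult_right[OF has_derivative_divide[OF comp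
          has_derivative_power[OF has_derivative_bubble_denominator] power_not_zero[OF bubble_denominator_nonzero]]]])
      (rule ext, rule alg[OF bubble_denominator_nonzero])
qed

lemma partial_bubble_differentiable: "partial i (bubble \<rho> p) differentiable (at x)"
  using has_derivative_partial_bubble by (rule differentiableI)

lemma partial_partial_bubble:
  "partial i (partial i (bubble \<rho> p)) x = - \<rho> / sqrt (\<rho>\<^sup>2 + (norm (x - p))\<^sup>2) ^ 3
    + 3 * \<rho> * ((x - p) $ i)\<^sup>2 / sqrt (\<rho>\<^sup>2 + (norm (x - p))\<^sup>2) ^ 5"
proof -
  have alg: "- \<rho> * (1 / a - 3 * y * (y * 1) / b) = - \<rho> / a + 3 * \<rho> * y\<^sup>2 / b" for a b y
    by (simp add: algebra_simps power2_eq_square)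
  have "axis i 1 $ i = (1::real)"
    by (simp add: axis_def)
  then show ?thesis
    unfolding partial_eqI[OF has_derivative_partial_bubble] inner_axis inner_real_def by (simp only: alg)
qed

lemma continuous_partial_partial_bubble: "continuous_on UNIV (partial i (partial i (bubble \<rho> p)))"
  unfolding partial_partial_bubble[abs_def]
  by (intro continuous_intros) (rule ballI power_not_zero bubble_denominator_nonzero)+

end

text \<open>The dimension and the coefficient from the second differentiation are both 3, so the
  terms in |x - p|^2 cancel and only \<open>\<rho>\<^sup>2\<close> remains in the numerator.\<close>

lemma laplacian_bubble:
  fixes p x :: "real^3"
  assumes "0 < \<rho>"
  shows "(\<Sum>i\<in>UNIV. partial i (partial i (bubble \<rho> p)) x) = - 3 * \<rho> ^ 3 / sqrt (\<rho>\<^sup>2 + (norm (x - p))\<^sup>2) ^ 5"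
proof -
  define s where "s = sqrt (\<rho>\<^sup>2 + (norm (x - p))\<^sup>2)"
  have s: "0 < s" "s\<^sup>2 = \<rho>\<^sup>2 + (norm (x - p))\<^sup>2"
    using bubble_denominator_pos[OF assms, where x = x and p = p] by (auto simp: s_def)
  have n: "(norm (x - p))\<^sup>2 = (\<Sum>i\<in>UNIV. ((x - p) $ i)\<^sup>2)"
    by (simp only: power2_norm_eq_inner inner_vec_def inner_real_def flip: power2_eq_square)
  have "(\<Sum>i\<in>UNIV. partial i (partial i (bubble \<rho> p)) x)
      = (\<Sum>i\<in>(UNIV::3 set). - \<rho> / s ^ 3 + 3 * \<rho> / s ^ 5 * ((x - p) $ i)\<^sup>2)"
    by (simp only: partial_partial_bubble[OF assms] s_def times_divide_eq_left)
  also have "\<dots> = 3 * (- \<rho> / s ^ 3) + 3 * \<rho> / s ^ 5 * (norm (x - p))\<^sup>2"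
    unfolding n sum.distrib sum_distrib_left by simp
  also have "\<dots> = (3 * \<rho> * (norm (x - p))\<^sup>2 - 3 * \<rho> * s\<^sup>2) / s ^ 5"
  proof -
    have "s ^ 5 = s ^ 3 * s\<^sup>2" by (simp flip: power_add)
    then show ?thesis using s(1) by (simp add: divide_simps) (simp add: algebra_simps)
  qed
  also have "\<dots> = - 3 * \<rho> ^ 3 / s ^ 5"
    unfolding s(2) by (simp add: algebra_simps power2_eq_square power3_eq_cube)
  finally show ?thesis by (simp add: s_def)
qed

text \<open>On the ball, \<open>s\<^sup>2 \<le> 5 \<rho>\<^sup>2\<close> and hence
  \<open>s \<le> 3 \<rho>\<close>, so \<open>s ^ 5\<close> is at most \<open>25 * 3\<close> times
  \<open>\<rho> ^ 5\<close>; the 3 cancels against the 3 of the Laplacian. Outside the ball only the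
  sign matters.\<close>

lemma laplacian_bubble_le:
  fixes p x :: "real^3"
  assumes \<rho>: "0 < \<rho>"
  shows "indicator (ball p (2 * \<rho>)) x / (25 * \<rho>\<^sup>2) \<le> - (\<Sum>i\<in>UNIV. partial i (partial i (bubble \<rho> p)) x)"
proof -
  define s where "s = sqrt (\<rho>\<^sup>2 + (norm (x - p))\<^sup>2)"
  have s: "0 < s" "s\<^sup>2 = \<rho>\<^sup>2 + (norm (x - p))\<^sup>2"
    using bubble_denominator_pos[OF assms, where x = x and p = p] by (auto simp: s_def)
  have L: "- (\<Sum>i\<in>UNIV. partial i (partial i (bubble \<rho> p)) x) = 3 * \<rho> ^ 3 / s ^ 5"
    by (simp add: laplacian_bubble[OF \<rho>] s_def)
  show ?thesis
  proof (cases "x \<in> ball p (2 * \<rho>)")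
    case True
    then have "norm (x - p) \<le> 2 * \<rho>"
      by (simp add: dist_norm norm_minus_commute)
    then have "(norm (x - p))\<^sup>2 \<le> (2 * \<rho>)\<^sup>2"
      by (rule power_mono) simp
    then have s2: "s\<^sup>2 \<le> 5 * \<rho>\<^sup>2"
      unfolding s(2) four_x_squared[symmetric] by linarith
    also have "\<dots> \<le> (3 * \<rho>)\<^sup>2"
      unfolding power_mult_distrib by (intro mult_right_mono) simp_all
    finally have s1: "s \<le> 3 * \<rho>"
      by (rule power2_le_imp_le) (use \<rho> in simp)
    have "s ^ 5 = (s\<^sup>2)\<^sup>2 * s"
      by (simp add: numeral_eq_Suc)
    also have "\<dots> \<le> (5 * \<rho>\<^sup>2)\<^sup>2 * (3 * \<rho>)"
      by (rule mult_mono[OF power_mono[OF s2] s1]) (use s(1) in simp_all)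
    also have "\<dots> = 75 * \<rho> ^ 5"
      by (simp add: power_mult_distrib numeral_eq_Suc)
    finally have "s ^ 5 \<le> 75 * \<rho> ^ 5" .
    moreover have "75 * \<rho> ^ 5 = 3 * \<rho> ^ 3 * (25 * \<rho>\<^sup>2)"
      by (simp flip: power_add)
    ultimately have "1 / (25 * \<rho>\<^sup>2) \<le> 3 * \<rho> ^ 3 / s ^ 5"
      using \<rho> s(1) by (simp add: divide_simps mult.commute)
    then show ?thesis using True unfolding L by (simp only: indicator_simps)
  next
    case False
    have "0 \<le> 3 * \<rho> ^ 3 / s ^ 5"
      using s(1) \<rho> by (intro divide_nonneg_nonneg mult_nonneg_nonneg zero_le_power) simp_all
    moreover have "indicator (ball p (2 * \<rho>)) x = (0::real)"
      using False by simp
    ultimately show ?thesis unfolding L by (simp only: div_0)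
  qed
qed

lemma partial_sum:
  assumes "\<And>j. j \<in> J \<Longrightarrow> f j differentiable (at x)"
  shows "partial i (\<lambda>x. \<Sum>j\<in>J. f j x) x = (\<Sum>j\<in>J. partial i (f j) x)"
proof -
  have "((\<lambda>x. \<Sum>j\<in>J. f j x) has_derivative (\<lambda>h. \<Sum>j\<in>J. grad (f j) x \<bullet> h)) (at x)"
    by (intro has_derivative_sum has_derivative_grad assms)
  from partial_eqI[OF this] show ?thesis
    by (simp add: grad_def inner_axis)
qed

lemma C2c_integrable_square:
  assumes \<phi>: "\<phi> \<in> C2c"
  shows "integrable lebesgue (\<lambda>x. (\<phi> x)\<^sup>2)"
proof -
  obtain B where "\<And>x. B < norm x \<Longrightarrow> \<phi> x = 0"
    using C2c_support[OF \<phi>] by metis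
  then show ?thesis
    by (intro integrable_lebesgue_continuous_bounded_support[where B = B])
      (auto intro!: continuous_intros C2c_continuous[OF \<phi>])
qed

lemma C2c_sum_ball_integral_le:
  fixes p :: "'i \<Rightarrow> real^3"
  assumes \<rho>: "0 < \<rho>" and J: "finite J" "J \<noteq> {}"
    and M: "\<And>x. (\<Sum>j\<in>J. bubble \<rho> (p j) x) \<le> M" and \<phi>: "\<phi> \<in> C2c"
  shows "(\<Sum>j\<in>J. LINT x:ball (p j) (2 * \<rho>)|lebesgue. (\<phi> x)\<^sup>2)
    \<le> 25 * \<rho>\<^sup>2 * M * (LINT x|lebesgue. (norm (grad \<phi> x))\<^sup>2)"
proof -
  define W where "W x = (\<Sum>j\<in>J. bubble \<rho> (p j) x)" for x
  \<comment> \<open>A lower bound for \<open>- \<Delta>W / W\<close>: the numerators come from the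
    individual bubbles, and \<open>W\<close> in the denominator is replaced by its bound
    \<open>M\<close>.\<close>
  define V where "V x = (\<Sum>j\<in>J. indicator (ball (p j) (2 * \<rho>)) x) / (25 * \<rho>\<^sup>2 * M)" for x
  have W_pos: "0 < W x" for x
    unfolding W_def using J by (intro sum_pos bubble_pos \<rho>) auto
  have M_pos: "0 < M"
    using W_pos[of 0] M[of 0] by (simp add: W_def)
  have c_pos: "0 < 25 * \<rho>\<^sup>2 * M"
    using \<rho> M_pos by simp
  have W': "partial i W = (\<lambda>x. \<Sum>j\<in>J. partial i (bubble \<rho> (p j)) x)" for i
    unfolding W_def by (intro ext partial_sum bubble_differentiable \<rho>)
  have W'': "partial l (partial i W) = (\<lambda>x. \<Sum>j\<in>J. partial l (partial i (bubble \<rho> (p j))) x)" for i l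
    unfolding W' by (intro ext partial_sum partial_bubble_differentiable \<rho>)
  have int: "integrable lebesgue (\<lambda>x. indicator (ball (p j) (2 * \<rho>)) x * (\<phi> x)\<^sup>2)" for j
    using integrable_mult_indicator[OF _ C2c_integrable_square[OF \<phi>], of "ball (p j) (2 * \<rho>)"] by simp
  have V_eq: "V x * (\<phi> x)\<^sup>2 = (\<Sum>j\<in>J. indicator (ball (p j) (2 * \<rho>)) x * (\<phi> x)\<^sup>2) / (25 * \<rho>\<^sup>2 * M)" for x
    unfolding V_def by (simp only: sum_distrib_right times_divide_eq_left)
  have "(LINT x|lebesgue. V x * (\<phi> x)\<^sup>2) \<le> (LINT x|lebesgue. (norm (grad \<phi> x))\<^sup>2)"
  proof (rule ground_state_inequality[OF _ _ _ W_pos _ \<phi>])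
    show "W differentiable (at x)" for x
      unfolding W_def using J by (intro differentiable_sum ballI bubble_differentiable \<rho>)
    show "partial i W differentiable (at x)" for i x
      unfolding W' using J by (intro differentiable_sum ballI partial_bubble_differentiable \<rho>)
    show "continuous_on UNIV (partial i (partial i W))" for i
      unfolding W'' by (intro continuous_on_sum continuous_partial_partial_bubble \<rho>)
    show "integrable lebesgue (\<lambda>x. V x * (\<phi> x)\<^sup>2)"
      unfolding V_eq by (intro Bochner_Integration.integrable_divide Bochner_Integration.integrable_sum int)
    fix x
    have "V x * W x \<le> V x * M"
    proof (rule mult_left_mono)
      show "W x \<le> M" unfolding W_def by (rule M)
      show "0 \<le> V x"
        unfolding V_def using c_pos by (intro divide_nonneg_pos sum_nonneg) simp_all
    qed
    also have "\<dots> = (\<Sum>j\<in>J. indicator (ball (p j) (2 * \<rho>)) x / (25 * \<rho>\<^sup>2))"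
      using M_pos by (simp add: V_def flip: sum_divide_distrib)
    also have "\<dots> \<le> (\<Sum>j\<in>J. - (\<Sum>i\<in>UNIV. partial i (partial i (bubble \<rho> (p j))) x))"
      by (intro sum_mono laplacian_bubble_le \<rho>)
    also have "\<dots> = - (\<Sum>i\<in>UNIV. partial i (partial i W) x)"
      unfolding W'' sum_negf by (simp only: sum.swap[of _ UNIV])
    finally show "V x * W x \<le> - (\<Sum>i\<in>UNIV. partial i (partial i W) x)" .
  qed
  moreover have "(LINT x|lebesgue. V x * (\<phi> x)\<^sup>2)
      = (\<Sum>j\<in>J. LINT x:ball (p j) (2 * \<rho>)|lebesgue. (\<phi> x)\<^sup>2) / (25 * \<rho>\<^sup>2 * M)"
    unfolding V_eq set_lebesgue_integral_def real_scaleR_def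
    by (simp only: Bochner_Integration.integral_divide_zero Bochner_Integration.integral_sum[OF int])
  ultimately show ?thesis
    using c_pos by (simp only: pos_divide_le_eq mult.commute)
qed

section \<open>Regularly spaced points on a circle\<close>

text \<open>Indices start at 0 and are not bounded by \<open>k\<close>: index \<open>k\<close> is
  the starting point again, so that rotation is simply \<open>Suc\<close> on indices.\<close>

definition ring_point :: "real \<Rightarrow> nat \<Rightarrow> nat \<Rightarrow> real^3" where
  "ring_point s k j = vector [s * cos (2 * pi * real j / real k), s * sin (2 * pi * real j / real k), 0]"

lemma norm_square_real3: "(norm (x :: real^3))\<^sup>2 = (x $ 1)\<^sup>2 + (x $ 2)\<^sup>2 + (x $ 3)\<^sup>2"
  by (simp only: power2_norm_eq_inner inner_vec_def sum_3 inner_real_def flip: power2_eq_square)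

text \<open>A chord of a circle of radius \<open>s\<close> is \<open>2 * s\<close> times the sine of
  half the angle; the sum-to-product formulas give it.\<close>

lemma norm_ring_point_diff:
  assumes "0 \<le> s"
  shows "norm (ring_point s k i - ring_point s k j) = 2 * s * \<bar>sin (pi * (real i - real j) / real k)\<bar>"
proof -
  define \<alpha> \<beta> where "\<alpha> = 2 * pi * real i / real k" and "\<beta> = 2 * pi * real j / real k"
  have half: "(\<alpha> - \<beta>) / 2 = pi * (real i - real j) / real k"
    by (simp add: \<alpha>_def \<beta>_def diff_divide_distrib right_diff_distrib)
  define u v where "u = (\<alpha> - \<beta>) / 2" and "v = (\<alpha> + \<beta>) / 2"
  have c: "cos \<alpha> - cos \<beta> = - 2 * sin v * sin u"
    using cos_diff_cos[of \<alpha> \<beta>] sin_minus[of u] by (simp add: u_def v_def minus_divide_left)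
  have d: "sin \<alpha> - sin \<beta> = 2 * sin u * cos v"
    using sin_diff_sin[of \<alpha> \<beta>] by (simp add: u_def v_def)
  have "(norm (ring_point s k i - ring_point s k j))\<^sup>2 = (s * (cos \<alpha> - cos \<beta>))\<^sup>2 + (s * (sin \<alpha> - sin \<beta>))\<^sup>2"
    by (simp add: norm_square_real3 ring_point_def \<alpha>_def \<beta>_def right_diff_distrib)
  also have "\<dots> = (2 * s * sin u)\<^sup>2 * ((sin v)\<^sup>2 + (cos v)\<^sup>2)"
  proof -
    have "(s * (- 2 * a * b))\<^sup>2 + (s * (2 * b * c))\<^sup>2 = (2 * s * b)\<^sup>2 * (a\<^sup>2 + c\<^sup>2)" for a b c
      by (simp add: power2_eq_square algebra_simps)
    then show ?thesis unfolding c d .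
  qed
  also have "\<dots> = (2 * s * \<bar>sin u\<bar>)\<^sup>2"
    unfolding sin_cos_squared_add mult_1_right power_mult_distrib[of "2 * s"] power2_abs ..
  finally show ?thesis
    unfolding u_def half by (rule power2_eq_imp_eq) (simp_all add: assms)
qed

text \<open>The Taylor polynomial of degree 2 is \<open>u\<close>, and its error
  \<open>u ^ 3 / 6\<close> is at most \<open>2 * u / 3\<close> because
  \<open>u \<le> 2\<close>.\<close>

lemma sin_ge_third:
  fixes u :: real
  assumes "0 \<le> u" "u \<le> pi / 2"
  shows "u / 3 \<le> sin u"
proof -
  have "\<bar>sin u - (\<Sum>m<3. sin_coeff m * u ^ m)\<bar> \<le> inverse (fact 3) * \<bar>u\<bar> ^ 3"
    by (rule Maclaurin_sin_bound)
  moreover have "(\<Sum>m<3. sin_coeff m * u ^ m) = u"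
    by (simp add: eval_nat_numeral sin_coeff_def)
  moreover have "inverse (fact 3) * \<bar>u\<bar> ^ 3 \<le> 2 * u / 3"
  proof -
    have "u \<le> 2" using assms(2) pi_less_4 by linarith
    then have "u * (u * u) \<le> u * (2 * 2)"
      using assms(1) by (intro mult_left_mono mult_mono) auto
    then show ?thesis
      using assms(1) by (simp add: power3_eq_cube fact_numeral)
  qed
  ultimately show ?thesis by linarith
qed

text \<open>The double angle formula splits the sine into two factors, one vanishing at each end,
  and each is bounded below linearly. The constant is \<open>pi\<^sup>2 / 18\<close>, at least
  \<open>1 / 2\<close>. A product \<open>x * (1 - x)\<close> is wanted because its reciprocal splits
  into partial fractions.\<close>

lemma sin_pi_mult_ge:
  fixes x :: real
  assumes "0 \<le> x" "x \<le> 1"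
  shows "x * (1 - x) / 2 \<le> sin (pi * x)"
proof -
  have 1: "pi * x / 2 / 3 \<le> sin (pi * x / 2)"
    using assms by (intro sin_ge_third) (simp_all add: mult_left_le)
  have 2: "pi * (1 - x) / 2 / 3 \<le> sin (pi * (1 - x) / 2)"
    using assms by (intro sin_ge_third) (simp_all add: mult_left_le)
  have "sin (pi * (1 - x) / 2) = cos (pi * x / 2)"
    by (simp add: right_diff_distrib diff_divide_distrib cos_sin_eq)
  then have eq: "sin (pi * x) = 2 * (sin (pi * x / 2) * sin (pi * (1 - x) / 2))"
    using sin_double[of "pi * x / 2"] by simp
  have "3 * 3 \<le> pi * pi"
    using pi_gt3 by (intro mult_mono) auto
  then have "9 * (x * (1 - x)) \<le> (pi * pi) * (x * (1 - x))"
    using assms by (intro mult_right_mono) auto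
  moreover have "2 * ((pi * x / 2 / 3) * (pi * (1 - x) / 2 / 3)) = (pi * pi) * (x * (1 - x)) / 18"
    by simp
  ultimately have "x * (1 - x) / 2 \<le> 2 * ((pi * x / 2 / 3) * (pi * (1 - x) / 2 / 3))"
    by linarith
  also have "\<dots> \<le> sin (pi * x)"
    unfolding eq using assms by (intro mult_left_mono mult_mono 1 2 sin_ge_zero) (auto simp: mult_left_le)
  finally show ?thesis .
qed

lemma norm_ring_point_diff_ge:
  assumes s: "0 \<le> s" and d: "real i - real j = real d \<or> real j - real i = real d" "d < k"
  shows "s * (real d / real k * (1 - real d / real k)) \<le> norm (ring_point s k i - ring_point s k j)"
proof -
  define x where "x = real d / real k"
  have x: "0 \<le> x" "x \<le> 1" using d by (auto simp: x_def)
  have "\<bar>sin (pi * (real i - real j) / real k)\<bar> = \<bar>sin (pi * x)\<bar>"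
  proof (cases "real i - real j = real d")
    case False
    then have "real i - real j = - real d"
      using d(1) by linarith
    then have "pi * (real i - real j) / real k = - (pi * x)"
      by (simp add: x_def)
    then show ?thesis by (simp only: sin_minus abs_minus_cancel)
  qed (simp add: x_def)
  then have "norm (ring_point s k i - ring_point s k j) = 2 * s * \<bar>sin (pi * x)\<bar>"
    using s by (simp add: norm_ring_point_diff)
  also have "\<dots> \<ge> 2 * s * (x * (1 - x) / 2)"
    using sin_pi_mult_ge[of x] x s by (intro mult_left_mono) auto
  finally show ?thesis
    by (simp add: x_def)
qed

lemma ring_point_neq:
  assumes s: "0 < s" and ij: "i < k" "j < k" "i \<noteq> j"
  shows "ring_point s k i \<noteq> ring_point s k j"
proof -
  obtain d where d: "0 < d" "d < k" "real i - real j = real d \<or> real j - real i = real d"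
    using ij by (cases "j < i") (auto intro: that[of "i - j"] that[of "j - i"] simp: of_nat_diff)
  have "0 < s * (real d / real k * (1 - real d / real k))"
    using s d by simp
  also have "\<dots> \<le> norm (ring_point s k i - ring_point s k j)"
    using norm_ring_point_diff_ge[OF less_imp_le[OF s] d(3) d(2)] .
  finally show ?thesis by auto
qed

text \<open>Partial fractions of \<open>1 / (x * (1 - x))\<close>: the two terms count the steps
  between the points along the two arcs, so the estimate is good for nearly opposite indices as well
  as for neighbours.\<close>

lemma inverse_norm_ring_point_diff_le:
  assumes s: "0 < s" and d: "real i - real j = real d \<or> real j - real i = real d" "0 < d" "d < k"
  shows "1 / norm (ring_point s k i - ring_point s k j) \<le> real k / s * (1 / real d + 1 / real (k - d))"
proof -
  define x where "x = real d / real k"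
  have x: "0 < x" "x < 1" using d by (auto simp: x_def)
  have pos: "0 < s * (x * (1 - x))"
    using s x by simp
  have "s * (x * (1 - x)) \<le> norm (ring_point s k i - ring_point s k j)"
    using norm_ring_point_diff_ge[OF less_imp_le[OF s] d(1,3)] unfolding x_def .
  with pos have "1 / norm (ring_point s k i - ring_point s k j) \<le> 1 / (s * (x * (1 - x)))"
    by (rule frac_le[OF zero_le_one order_refl])
  also have "\<dots> = 1 / s * (1 / x + 1 / (1 - x))"
    using s x by (simp add: field_simps)
  also have "1 - x = real (k - d) / real k"
    using d by (simp add: x_def diff_divide_distrib of_nat_diff)
  finally show ?thesis
    by (simp add: x_def algebra_simps add_divide_distrib)
qed

text \<open>Both \<open>d\<close> and \<open>k - d\<close> take distinct values in
  \<open>{1..k}\<close>, so each half of the sum is part of the harmonic sum.\<close>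

lemma sum_inverse_inj_le_harm:
  assumes d: "inj_on d A" "d ` A \<subseteq> {1..<k}"
  shows "(\<Sum>j\<in>A. 1 / real (d j) + 1 / real (k - d j)) \<le> 2 * harm k"
proof -
  have gen: "(\<Sum>j\<in>A. 1 / real (e j)) \<le> harm k" if "inj_on e A" "e ` A \<subseteq> {1..k}" for e
  proof -
    have "(\<Sum>j\<in>A. 1 / real (e j)) = (\<Sum>n\<in>e ` A. 1 / real n)"
      by (simp add: sum.reindex[OF that(1)])
    also have "\<dots> \<le> (\<Sum>n\<in>{1..k}. 1 / real n)"
      using that(2) by (intro sum_mono2) auto
    finally show ?thesis
      by (simp add: harm_def inverse_eq_divide)
  qed
  have "inj_on (\<lambda>j. k - d j) A"
  proof (rule inj_onI)
    fix i j assume ij: "i \<in> A" "j \<in> A" "k - d i = k - d j"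
    then have "d i < k" "d j < k" using d(2) by auto
    then have "d i = d j" using ij(3) by simp
    then show "i = j" using d(1) ij by (auto dest: inj_onD)
  qed
  moreover have "(\<lambda>j. k - d j) ` A \<subseteq> {1..k}"
    using d(2) by force
  moreover have "d ` A \<subseteq> {1..k}"
    using d(2) by force
  ultimately show ?thesis
    using gen[of d] gen[of "\<lambda>j. k - d j"] d(1) by (simp add: sum.distrib)
qed

text \<open>On each side of \<open>m\<close> the index distances are distinct, and each side costs
  two harmonic sums, one per arc.\<close>

lemma sum_inverse_norm_ring_point_le:
  assumes s: "0 < s" and m: "m < k"
  shows "(\<Sum>j\<in>{..<k} - {m}. 1 / norm (ring_point s k j - ring_point s k m)) \<le> 4 * (real k / s) * harm k"
proof -
  let ?f = "\<lambda>j. 1 / norm (ring_point s k j - ring_point s k m)"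
  have part: "(\<Sum>j\<in>A. ?f j) \<le> real k / s * (2 * harm k)"
    if "inj_on d A" "d ` A \<subseteq> {1..<k}" "\<And>j. j \<in> A \<Longrightarrow> real j - real m = real (d j) \<or> real m - real j = real (d j)" for A d
  proof -
    have "(\<Sum>j\<in>A. ?f j) \<le> (\<Sum>j\<in>A. real k / s * (1 / real (d j) + 1 / real (k - d j)))"
      using that(2,3) by (intro sum_mono inverse_norm_ring_point_diff_le s) (force simp: image_subset_iff)+
    also have "\<dots> = real k / s * (\<Sum>j\<in>A. 1 / real (d j) + 1 / real (k - d j))"
      by (rule sum_distrib_left[symmetric])
    also have "\<dots> \<le> real k / s * (2 * harm k)"
      using s by (intro mult_left_mono sum_inverse_inj_le_harm that) auto
    finally show ?thesis .
  qed
  have "(\<Sum>j\<in>{..<m}. ?f j) \<le> real k / s * (2 * harm k)"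
    by (rule part[of "\<lambda>j. m - j"]) (use m in \<open>auto simp: inj_on_def of_nat_diff\<close>)
  moreover have "(\<Sum>j\<in>{m<..<k}. ?f j) \<le> real k / s * (2 * harm k)"
    by (rule part[of "\<lambda>j. j - m"]) (use m in \<open>auto simp: inj_on_def of_nat_diff\<close>)
  moreover have "{..<k} - {m} = {..<m} \<union> {m<..<k}"
    using m by auto
  moreover have "(\<Sum>j\<in>{..<m} \<union> {m<..<k}. ?f j) = (\<Sum>j\<in>{..<m}. ?f j) + (\<Sum>j\<in>{m<..<k}. ?f j)"
    by (rule sum.union_disjoint) auto
  moreover have "4 * (real k / s) * harm k = real k / s * (2 * harm k) + real k / s * (2 * harm k)"
    by simp
  ultimately show ?thesis by (simp only:)
qed

text \<open>The sequence defining the Euler-Mascheroni constant decreases from its value 1 at index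
  1.\<close>

lemma harm_le_ln: "0 < k \<Longrightarrow> harm k \<le> 1 + ln (real k)"
  using euler_mascheroni_sequence_decreasing[of 1 k] by (simp add: harm_expand)

text \<open>The points other than the one nearest to \<open>x\<close> are at least half as far from \<open>x\<close> as from the nearest one.\<close>

lemma sum_bubble_ring_point_le:
  assumes \<rho>: "0 < \<rho>" and s: "0 < s" and k: "0 < k"
  shows "(\<Sum>j<k. bubble \<rho> (ring_point s k j) x) \<le> 1 + 8 * \<rho> * real k / s * (1 + ln (real k))"
proof -
  let ?p = "ring_point s k"
  obtain m where m: "m < k" "\<And>j. j < k \<Longrightarrow> norm (x - ?p m) \<le> norm (x - ?p j)"
  proof -
    have "finite ((\<lambda>j. norm (x - ?p j)) ` {..<k})" "(\<lambda>j. norm (x - ?p j)) ` {..<k} \<noteq> {}"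
      using k by auto
    from Min_in[OF this] obtain m where m: "m < k" "Min ((\<lambda>j. norm (x - ?p j)) ` {..<k}) = norm (x - ?p m)"
      by auto
    have "norm (x - ?p m) \<le> norm (x - ?p j)" if "j < k" for j
      unfolding m(2)[symmetric] using that by (intro Min_le) auto
    with m(1) show thesis by (rule that)
  qed
  have sq: "\<bar>a\<bar> \<le> sqrt (\<rho>\<^sup>2 + a\<^sup>2)" for a
    by (rule real_le_rsqrt) simp
  \<comment> \<open>The nearest point may coincide with \<open>x\<close>, so only the maximum value
    of its bubble is available.\<close>
  have b1: "bubble \<rho> (?p m) x \<le> 1"
  proof -
    have "\<rho> \<le> sqrt (\<rho>\<^sup>2 + (norm (x - ?p m))\<^sup>2)"
      by (rule real_le_rsqrt) simp
    then show ?thesis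
      unfolding bubble_def using real_sqrt_gt_zero[OF bubble_denominator_pos[OF \<rho>, of x "?p m"]]
      by (simp only: divide_le_eq_1_pos)
  qed
  have b2: "bubble \<rho> (?p j) x \<le> 2 * \<rho> * (1 / norm (?p j - ?p m))" if j: "j \<in> {..<k} - {m}" for j
  proof -
    have pos: "0 < norm (?p j - ?p m)"
      using ring_point_neq[OF s, of j k m] j m(1) by simp
    have "norm (?p j - ?p m) \<le> norm (x - ?p m) + norm (x - ?p j)"
      using norm_triangle_ineq4[of "x - ?p m" "x - ?p j"] by simp
    also have "\<dots> \<le> 2 * norm (x - ?p j)"
      using m(2) j by simp
    finally have n: "norm (?p j - ?p m) \<le> 2 * sqrt (\<rho>\<^sup>2 + (norm (x - ?p j))\<^sup>2)"
      using sq[of "norm (x - ?p j)"] unfolding abs_norm_cancel by linarith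
    then have "\<rho> / sqrt (\<rho>\<^sup>2 + (norm (x - ?p j))\<^sup>2) \<le> \<rho> / (norm (?p j - ?p m) / 2)"
      using \<rho> pos by (intro divide_left_mono mult_pos_pos real_sqrt_gt_zero bubble_denominator_pos[OF \<rho>]) auto
    then show ?thesis by (simp add: bubble_def mult.commute)
  qed
  have "(\<Sum>j<k. bubble \<rho> (?p j) x) = bubble \<rho> (?p m) x + (\<Sum>j\<in>{..<k} - {m}. bubble \<rho> (?p j) x)"
    using m(1) by (intro sum.remove) auto
  also have "\<dots> \<le> 1 + (\<Sum>j\<in>{..<k} - {m}. 2 * \<rho> * (1 / norm (?p j - ?p m)))"
    by (intro add_mono b1 sum_mono b2)
  also have "\<dots> = 1 + 2 * \<rho> * (\<Sum>j\<in>{..<k} - {m}. 1 / norm (?p j - ?p m))"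
    by (simp only: sum_distrib_left)
  also have "\<dots> \<le> 1 + 2 * \<rho> * (4 * (real k / s) * (1 + ln (real k)))"
  proof -
    have "4 * (real k / s) * harm k \<le> 4 * (real k / s) * (1 + ln (real k))"
      using s k by (intro mult_left_mono harm_le_ln) auto
    with sum_inverse_norm_ring_point_le[OF s m(1)] show ?thesis
      using \<rho> by (intro add_left_mono mult_left_mono) auto
  qed
  finally show ?thesis by (simp add: mult_ac)
qed

section \<open>Passage to the limit and Voronoi cells\<close>

text \<open>On a set of finite measure \<open>L^6\<close> convergence implies \<open>L^2\<close>
  convergence, by the pointwise bound \<open>g\<^sup>2 \<le> e\<^sup>2 + g^6 / e^4\<close> in place
  of Holder's inequality.\<close>

lemma power6_tendsto_imp_set_integral_square_tendsto:
  fixes f :: "nat \<Rightarrow> 'a::euclidean_space \<Rightarrow> real"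
  assumes f: "\<And>n. f n \<in> borel_measurable lebesgue" "\<And>n. integrable lebesgue (\<lambda>x. \<bar>f n x\<bar> ^ 6)"
    and v: "v \<in> borel_measurable lebesgue" "integrable lebesgue (\<lambda>x. \<bar>v x\<bar> ^ 6)"
    and lim: "(\<lambda>n. LINT x|lebesgue. \<bar>f n x - v x\<bar> ^ 6) \<longlonglongrightarrow> 0"
    and S: "S \<in> lmeasurable"
  shows "(\<lambda>n. LINT x:S|lebesgue. (f n x)\<^sup>2) \<longlonglongrightarrow> (LINT x:S|lebesgue. (v x)\<^sup>2)"
proof -
  have S_meas [measurable]: "S \<in> sets lebesgue"
    using S by auto
  have S_int: "integrable lebesgue (indicator S :: 'a \<Rightarrow> real)"
    using S by (simp add: lmeasurable_iff_integrable)
  have bound: "indicator S x * (g x)\<^sup>2 \<le> e\<^sup>2 * indicator S x + 1 / e ^ 4 * \<bar>g x\<bar> ^ 6"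
    if "0 < e" for e x and g :: "'a \<Rightarrow> real"
  proof -
    have "(g x)\<^sup>2 \<le> e\<^sup>2 + 1 / e ^ 4 * \<bar>g x\<bar> ^ 6"
      using le_add_power_div[OF abs_ge_zero that, of "g x" 2 4] by simp
    moreover have "0 \<le> 1 / e ^ 4 * \<bar>g x\<bar> ^ 6"
      using that by (intro mult_nonneg_nonneg divide_nonneg_nonneg zero_le_power) simp_all
    ultimately show ?thesis
      by (cases "x \<in> S") (simp_all only: indicator_simps mult_1 mult_1_right mult_zero_left mult_zero_right add_0_left not_False_eq_True)
  qed
  have int: "integrable lebesgue (\<lambda>x. e\<^sup>2 * indicator S x + 1 / e ^ 4 * \<bar>g x\<bar> ^ 6)"
    if "integrable lebesgue (\<lambda>x. \<bar>g x\<bar> ^ 6)" for e and g :: "'a \<Rightarrow> real"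
    by (rule Bochner_Integration.integrable_add[OF integrable_mult_right[OF S_int] integrable_mult_right[OF that]])
  have sq_int: "integrable lebesgue (\<lambda>x. indicator S x * (g x)\<^sup>2)"
    if [measurable]: "g \<in> borel_measurable lebesgue" and g: "integrable lebesgue (\<lambda>x. \<bar>g x\<bar> ^ 6)" for g :: "'a \<Rightarrow> real"
  proof (rule Bochner_Integration.integrable_bound[OF int[OF g, of 1]])
    show "AE x in lebesgue. norm (indicator S x * (g x)\<^sup>2) \<le> norm (1\<^sup>2 * indicator S x + 1 / 1 ^ 4 * \<bar>g x\<bar> ^ 6)"
    proof (rule AE_I2)
      fix x
      have "norm (indicator S x * (g x)\<^sup>2) = indicator S x * (g x)\<^sup>2"
        by simp
      also have "\<dots> \<le> 1\<^sup>2 * indicator S x + 1 / 1 ^ 4 * \<bar>g x\<bar> ^ 6"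
        by (rule bound) simp
      finally show "norm (indicator S x * (g x)\<^sup>2) \<le> norm (1\<^sup>2 * indicator S x + 1 / 1 ^ 4 * \<bar>g x\<bar> ^ 6)"
        unfolding real_norm_def by linarith
    qed
  qed measurable
  have norm_eq: "(norm (indicator S x * c))\<^sup>2 = indicator S x * c\<^sup>2" for x and c :: real
    by (cases "x \<in> S") simp_all
  have square_integrable: "square_integrable lebesgue (\<lambda>x. indicator S x * g x)"
    if [measurable]: "g \<in> borel_measurable lebesgue" and g: "integrable lebesgue (\<lambda>x. \<bar>g x\<bar> ^ 6)" for g :: "'a \<Rightarrow> real"
    unfolding square_integrable_def norm_eq using sq_int[OF that] by simp
  have diff6: "integrable lebesgue (\<lambda>x. \<bar>f n x - v x\<bar> ^ 6)" and diff_meas: "(\<lambda>x. f n x - v x) \<in> borel_measurable lebesgue" for n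
    by (intro integrable_power6_diff borel_measurable_diff f v)+
  have "(\<lambda>n. LINT x|lebesgue. (norm (indicator S x * f n x - indicator S x * v x))\<^sup>2) \<longlonglongrightarrow> 0"
  proof (rule tendsto_0_of_weighted_bound[OF lim])
    fix e :: real assume e: "0 < e"
    define V where "V = measure lebesgue S"
    have V: "0 \<le> V" by (simp add: V_def)
    \<comment> \<open>The square root appears because the small term of the pointwise bound is
      quadratic in the parameter.\<close>
    define r where "r = sqrt (e / (V + 1))"
    have r: "0 < r" "r\<^sup>2 * V \<le> e"
      using e V by (simp_all add: r_def field_simps add_nonneg_pos)
    have "\<bar>LINT x|lebesgue. (norm (indicator S x * f n x - indicator S x * v x))\<^sup>2\<bar>
        \<le> e + 1 / r ^ 4 * (LINT x|lebesgue. \<bar>f n x - v x\<bar> ^ 6)" for n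
    proof -
      have "\<bar>LINT x|lebesgue. (norm (indicator S x * f n x - indicator S x * v x))\<^sup>2\<bar>
          = (LINT x|lebesgue. indicator S x * (f n x - v x)\<^sup>2)"
        unfolding right_diff_distrib[symmetric] norm_eq by (intro abs_of_nonneg integral_nonneg_AE AE_I2) simp
      also have "\<dots> \<le> (LINT x|lebesgue. r\<^sup>2 * indicator S x + 1 / r ^ 4 * \<bar>f n x - v x\<bar> ^ 6)"
        by (intro integral_mono sq_int diff_meas diff6 int bound r)
      also have "\<dots> = r\<^sup>2 * V + 1 / r ^ 4 * (LINT x|lebesgue. \<bar>f n x - v x\<bar> ^ 6)"
        unfolding Bochner_Integration.integral_add[OF integrable_mult_right[OF S_int] integrable_mult_right[OF diff6]]
          integral_mult_right_zero V_def by simp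
      finally show ?thesis
        using r(2) by linarith
    qed
    then show "\<exists>K. \<forall>n. \<bar>LINT x|lebesgue. (norm (indicator S x * f n x - indicator S x * v x))\<^sup>2\<bar>
        \<le> e + K * (LINT x|lebesgue. \<bar>f n x - v x\<bar> ^ 6)"
      by blast
  qed
  from integral_norm_square_tendsto[OF square_integrable[OF f] square_integrable[OF v] this]
  show ?thesis
    unfolding norm_eq set_lebesgue_integral_def real_scaleR_def .
qed

text \<open>The two sides pass to the limit for different reasons: the balls by \<open>L^6\<close>
  convergence of the functions, the energy by \<open>L^2\<close> convergence of the
  gradients.\<close>

lemma H1_pair_sum_ball_integral_le:
  fixes p :: "'i \<Rightarrow> real^3"
  assumes \<rho>: "0 < \<rho>" and J: "finite J" "J \<noteq> {}"
    and M: "\<And>x. (\<Sum>j\<in>J. bubble \<rho> (p j) x) \<le> M" and pair: "H1_pair v G"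
  shows "(\<Sum>j\<in>J. LINT x:ball (p j) (2 * \<rho>)|lebesgue. (v x)\<^sup>2)
    \<le> 25 * \<rho>\<^sup>2 * M * (LINT x|lebesgue. (norm (G x))\<^sup>2)"
proof -
  obtain \<phi> where \<phi>: "\<And>n. \<phi> n \<in> C2c" "(\<lambda>n. LINT x|lebesgue. \<bar>\<phi> n x - v x\<bar> ^ 6) \<longlonglongrightarrow> 0"
      "(\<lambda>n. LINT x|lebesgue. (norm (grad (\<phi> n) x - G x))\<^sup>2) \<longlonglongrightarrow> 0"
    using pair by (auto simp: H1_pair_def)
  have v: "v \<in> borel_measurable lebesgue" "integrable lebesgue (\<lambda>x. \<bar>v x\<bar> ^ 6)" "square_integrable lebesgue G"
    using pair by (auto simp: H1_pair_def)
  have "(\<lambda>n. LINT x:ball (p j) (2 * \<rho>)|lebesgue. (\<phi> n x)\<^sup>2) \<longlonglongrightarrow> (LINT x:ball (p j) (2 * \<rho>)|lebesgue. (v x)\<^sup>2)" for j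
    by (rule power6_tendsto_imp_set_integral_square_tendsto[OF C2c_measurable[OF \<phi>(1)] C2c_integrable_power6[OF \<phi>(1)] v(1,2) \<phi>(2)])
      simp
  then have "(\<lambda>n. \<Sum>j\<in>J. LINT x:ball (p j) (2 * \<rho>)|lebesgue. (\<phi> n x)\<^sup>2)
      \<longlonglongrightarrow> (\<Sum>j\<in>J. LINT x:ball (p j) (2 * \<rho>)|lebesgue. (v x)\<^sup>2)"
    by (intro tendsto_sum)
  moreover have "(\<lambda>n. 25 * \<rho>\<^sup>2 * M * (LINT x|lebesgue. (norm (grad (\<phi> n) x))\<^sup>2))
      \<longlonglongrightarrow> 25 * \<rho>\<^sup>2 * M * (LINT x|lebesgue. (norm (G x))\<^sup>2)"
    by (intro tendsto_mult_left integral_norm_square_tendsto[OF square_integrable_grad[OF \<phi>(1)] v(3) \<phi>(3)])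
  ultimately show ?thesis
    by (rule LIMSEQ_le) (use C2c_sum_ball_integral_le[OF \<rho> J M \<phi>(1)] in blast)
qed

lemma set_integral_orthogonal_invariant:
  fixes f :: "real^'n::{finite,wellorder} \<Rightarrow> real" and R :: "real^'n::_ \<Rightarrow> real^'n::_"
  assumes R: "orthogonal_transformation R" and f: "f \<in> borel_measurable lebesgue"
    and inv: "AE x in lebesgue. f (R x) = f x"
    and S: "S \<in> sets lebesgue" and T: "T \<in> sets lebesgue" and ST: "\<And>x. R x \<in> S \<longleftrightarrow> x \<in> T"
  shows "(LINT x:S|lebesgue. f x) = (LINT x:T|lebesgue. f x)"
proof -
  have [measurable]: "f \<in> borel_measurable lebesgue" "(\<lambda>x. f (R x)) \<in> borel_measurable lebesgue"
    "S \<in> sets lebesgue" "T \<in> sets lebesgue"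
    using f S T borel_measurable_lebesgue_orthogonal[OF R f] by auto
  have ind: "indicator S (R x) = (indicator T x :: real)" for x
    using ST by (simp add: indicator_def)
  have "(LINT x|lebesgue. indicator S x * f x) = (LINT x|lebesgue. indicator S (R x) * f (R x))"
    by (rule integral_lebesgue_orthogonal[OF R, of "\<lambda>x. indicator S x * f x", symmetric]) measurable
  also have "\<dots> = (LINT x|lebesgue. indicator T x * f x)"
    unfolding ind using inv by (intro integral_cong_AE) auto
  finally show ?thesis
    by (simp add: set_lebesgue_integral_def)
qed

section \<open>Voronoi cells as a partition up to null sets\<close>

definition voronoi_cell :: "'a::euclidean_space set \<Rightarrow> 'a \<Rightarrow> 'a set" where
  "voronoi_cell Z p = {x. \<forall>q\<in>Z - {p}. norm (x - p) < norm (x - q)}"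

lemma voronoi_cell_measurable:
  assumes "finite Z"
  shows "voronoi_cell Z p \<in> sets lebesgue"
proof -
  have "voronoi_cell Z p = (\<Inter>q\<in>Z - {p}. {x. norm (x - p) < norm (x - q)})"
    by (auto simp: voronoi_cell_def)
  moreover have "open (\<Inter>q\<in>Z - {p}. {x. norm (x - p) < norm (x - q)})"
    using assms by (intro open_INT ballI open_Collect_less continuous_intros) auto
  ultimately show ?thesis by (simp add: borel_open)
qed

lemma voronoi_cell_disjoint:
  assumes "p \<in> Z" "q \<in> Z" "x \<in> voronoi_cell Z p" "x \<in> voronoi_cell Z q"
  shows "p = q"
proof (rule ccontr)
  assume "p \<noteq> q"
  then have "norm (x - p) < norm (x - q)" "norm (x - q) < norm (x - p)"
    using assms by (auto simp: voronoi_cell_def)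
  then show False by simp
qed

text \<open>Squaring the norms removes the quadratic term in \<open>x\<close> and leaves a
  hyperplane with normal \<open>q - p\<close>.\<close>

lemma negligible_bisector:
  fixes p q :: "'a::euclidean_space"
  assumes "p \<noteq> q"
  shows "negligible {x. norm (x - p) = norm (x - q)}"
proof -
  have "{x. norm (x - p) = norm (x - q)} = {x. (2 *\<^sub>R (q - p)) \<bullet> x = q \<bullet> q - p \<bullet> p}"
  proof -
    have "norm (x - p) = norm (x - q) \<longleftrightarrow> (2 *\<^sub>R (q - p)) \<bullet> x = q \<bullet> q - p \<bullet> p" for x
    proof -
      have e: "(x - y) \<bullet> (x - y) = x \<bullet> x - 2 * (y \<bullet> x) + y \<bullet> y" for y
        by (simp add: inner_diff_left inner_diff_right inner_commute)
      have "(2 *\<^sub>R (q - p)) \<bullet> x = 2 * (q \<bullet> x) - 2 * (p \<bullet> x)"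
        by (simp add: inner_diff_left)
      then show ?thesis
        unfolding norm_eq e[of p] e[of q] by (intro iffI) linarith+
    qed
    then show ?thesis by simp
  qed
  then show ?thesis
    using assms by (simp only:) (intro negligible_hyperplane, simp)
qed

text \<open>A point that avoids the finitely many bisectors has a strictly nearest element of
  \<open>Z\<close>.\<close>

lemma AE_mem_voronoi_cell:
  fixes Z :: "'a::euclidean_space set"
  assumes Z: "finite Z" "Z \<noteq> {}"
  shows "AE x in lebesgue. \<exists>p\<in>Z. x \<in> voronoi_cell Z p"
proof -
  let ?N = "\<Union>(p, q)\<in>{(p, q) \<in> Z \<times> Z. p \<noteq> q}. {x. norm (x - p) = norm (x - q)}"
  have "finite {(p, q) \<in> Z \<times> Z. p \<noteq> q}"
    using Z by (intro finite_subset[OF _ finite_cartesian_product[OF Z(1) Z(1)]]) auto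
  then have "negligible ?N"
    by (intro negligible_Union finite_imageI) (auto intro: negligible_bisector)
  then have "AE x in lebesgue. x \<notin> ?N"
    by (simp only: negligible_iff_null_sets AE_not_in)
  then show ?thesis
  proof eventually_elim
    case (elim x)
    have fin: "finite ((\<lambda>p. norm (x - p)) ` Z)" "(\<lambda>p. norm (x - p)) ` Z \<noteq> {}"
      using Z by auto
    from Min_in[OF this] obtain p where p: "p \<in> Z" "Min ((\<lambda>p. norm (x - p)) ` Z) = norm (x - p)"
      by auto
    have le: "norm (x - p) \<le> norm (x - q)" if "q \<in> Z" for q
      unfolding p(2)[symmetric] using fin(1) that by (intro Min_le) auto
    have "norm (x - p) < norm (x - q)" if "q \<in> Z - {p}" for q
    proof -
      have "norm (x - p) \<noteq> norm (x - q)"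
        using that elim p(1) by auto
      with le[of q] that show ?thesis by simp
    qed
    then have "x \<in> voronoi_cell Z p"
      by (simp add: voronoi_cell_def)
    with p(1) show ?case by blast
  qed
qed

lemma integral_eq_sum_voronoi_cells:
  fixes f :: "'a::euclidean_space \<Rightarrow> real"
  assumes Z: "finite Z" "Z \<noteq> {}" and f: "integrable lebesgue f"
  shows "(LINT x|lebesgue. f x) = (\<Sum>p\<in>Z. LINT x:voronoi_cell Z p|lebesgue. f x)"
proof -
  have [measurable]: "f \<in> borel_measurable lebesgue" "\<And>p. voronoi_cell Z p \<in> sets lebesgue"
    using f voronoi_cell_measurable[OF Z(1)] by auto
  have "(LINT x|lebesgue. f x) = (LINT x|lebesgue. (\<Sum>p\<in>Z. indicator (voronoi_cell Z p) x * f x))"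
  proof (rule integral_cong_AE)
    show "AE x in lebesgue. f x = (\<Sum>p\<in>Z. indicator (voronoi_cell Z p) x * f x)"
      using AE_mem_voronoi_cell[OF Z]
    proof eventually_elim
      case (elim x)
      then obtain p where p: "p \<in> Z" "x \<in> voronoi_cell Z p" by blast
      have "(\<Sum>q\<in>Z. indicator (voronoi_cell Z q) x * f x) = (\<Sum>q\<in>Z. if q = p then f x else 0)"
      proof (rule sum.cong)
        fix q assume q: "q \<in> Z"
        show "indicator (voronoi_cell Z q) x * f x = (if q = p then f x else 0)"
        proof (cases "q = p")
          case False
          then have "x \<notin> voronoi_cell Z q"
            using voronoi_cell_disjoint[OF q p(1) _ p(2)] by blast
          with False show ?thesis by simp
        qed (use p(2) in simp)
      qed simp
      then show ?case using Z(1) p(1) by simp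
    qed
  qed measurable
  also have "\<dots> = (\<Sum>p\<in>Z. LINT x|lebesgue. indicator (voronoi_cell Z p) x * f x)"
    using integrable_mult_indicator[OF voronoi_cell_measurable[OF Z(1)] f]
    by (intro Bochner_Integration.integral_sum) simp
  finally show ?thesis
    by (simp add: set_lebesgue_integral_def)
qed

section \<open>Rotational symmetry and its almost everywhere form\<close>

definition rotation :: "real \<Rightarrow> real^3 \<Rightarrow> real^3" where
  "rotation \<theta> x = vector [cos \<theta> * x $ 1 - sin \<theta> * x $ 2, sin \<theta> * x $ 1 + cos \<theta> * x $ 2, x $ 3]"

lemma orthogonal_transformation_rotation: "orthogonal_transformation (rotation \<theta>)"
proof -
  have "linear (rotation \<theta>)"
    by (rule linearI) (simp_all add: rotation_def vec_eq_iff forall_3 algebra_simps)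
  moreover have "norm (rotation \<theta> x) = norm x" for x
  proof (rule power2_eq_imp_eq)
    have alg: "(c * a - s * b)\<^sup>2 + (s * a + c * b)\<^sup>2 = (c\<^sup>2 + s\<^sup>2) * (a\<^sup>2 + b\<^sup>2)" for a b c s :: real
      by (simp add: power2_eq_square algebra_simps)
    show "(norm (rotation \<theta> x))\<^sup>2 = (norm x)\<^sup>2"
      by (simp add: norm_square_real3 rotation_def alg)
  qed simp_all
  ultimately show ?thesis
    by (simp add: orthogonal_transformation)
qed

lemma rotation_ring_point:
  assumes "0 < k"
  shows "rotation (2 * pi / real k) (ring_point s k j) = ring_point s k (Suc j)"
proof -
  have "2 * pi * real (Suc j) / real k = 2 * pi / real k + 2 * pi * real j / real k"
    using assms by (simp add: field_simps)
  then show ?thesis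
    unfolding rotation_def ring_point_def
    by (simp only: cos_add sin_add) (simp add: vec_eq_iff forall_3 algebra_simps)
qed

lemma ring_point_self: "0 < k \<Longrightarrow> ring_point s k k = ring_point s k 0"
  by (simp add: ring_point_def)

text \<open>The definition speaks through polar coordinates with \<open>r > 0\<close> and is silent
  on the \<open>x\<^sub>3\<close>-axis. Discarding the plane where the first coordinate is 0 removes
  the axis, and elsewhere the coordinates exist.\<close>

lemma fold_symmetric_AE:
  assumes "fold_symmetric k v"
  shows "AE x in lebesgue. v (rotation (2 * pi / real k) x) = v x"
proof -
  have "negligible {x :: real^3. axis 1 1 \<bullet> x = 0}"
    by (rule negligible_hyperplane) (simp add: axis_eq_0_iff)
  then have "AE x in lebesgue. x \<notin> {x :: real^3. axis 1 1 \<bullet> x = 0}"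
    by (simp only: negligible_iff_null_sets AE_not_in)
  with assms[unfolded fold_symmetric_def] show ?thesis
  proof eventually_elim
    case (elim x)
    define r where "r = sqrt ((x $ 1)\<^sup>2 + (x $ 2)\<^sup>2)"
    have "x $ 1 \<noteq> 0"
      using elim(2) by (simp add: inner_axis')
    then have r2: "0 < (x $ 1)\<^sup>2 + (x $ 2)\<^sup>2"
      by (intro add_pos_nonneg) simp_all
    then have r: "0 < r" by (simp add: r_def)
    have "(x $ 1 / r)\<^sup>2 + (x $ 2 / r)\<^sup>2 = 1"
      unfolding power_divide add_divide_distrib[symmetric] r_def real_sqrt_pow2[OF less_imp_le[OF r2]]
      using less_imp_neq[OF r2, symmetric] by (rule divide_self)
    then obtain \<theta> where \<theta>: "0 \<le> \<theta>" "\<theta> < 2 * pi" "x $ 1 / r = cos \<theta>" "x $ 2 / r = sin \<theta>"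
      by (rule sincos_total_2pi)
    have x: "x $ 1 = r * cos \<theta>" "x $ 2 = r * sin \<theta>"
      using r by (simp_all flip: \<theta>(3,4))
    have "x = vector [r * cos \<theta>, r * sin \<theta>, x $ 3]"
      by (simp add: vec_eq_iff forall_3 x)
    with elim(1) r \<theta>(1,2) have "v x = v (vector [r * cos (\<theta> + 2 * pi / real k), r * sin (\<theta> + 2 * pi / real k), x $ 3])"
      by auto
    also have "vector [r * cos (\<theta> + 2 * pi / real k), r * sin (\<theta> + 2 * pi / real k), x $ 3] = rotation (2 * pi / real k) x"
      by (simp add: rotation_def x cos_add sin_add algebra_simps)
    finally show ?case by simp
  qed
qed

text \<open>What has to be supplied is measurability of the gradient, which integrability of its
  squared norm does not yield. Local integrability gives it on every ball, and the truncations
  converge pointwise.\<close>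

lemma homogeneous_H1_imp_H1_pair:
  assumes v: "v \<in> homogeneous_H1"
  shows "H1_pair v (weak_gradient v)"
proof -
  have "\<exists>G. has_weak_gradient v G"
    using v by (simp add: homogeneous_H1_def)
  then have "has_weak_gradient v (weak_gradient v)"
    unfolding weak_gradient_def by (rule someI_ex)
  then have loc: "set_integrable lebesgue (cball 0 (real n)) (weak_gradient v)" for n
    by (auto simp: has_weak_gradient_def locally_integrable_def)
  have "weak_gradient v \<in> borel_measurable lebesgue"
  proof (rule borel_measurable_LIMSEQ_metric)
    show "(\<lambda>x. indicator (cball 0 (real n)) x *\<^sub>R weak_gradient v x) \<in> borel_measurable lebesgue" for n
      using loc[of n] unfolding set_integrable_def by (rule borel_measurable_integrable)
    show "(\<lambda>n. indicator (cball 0 (real n)) x *\<^sub>R weak_gradient v x) \<longlonglongrightarrow> weak_gradient v x" for x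
    proof (rule tendsto_eventually)
      obtain N where "norm x \<le> real N" using real_arch_simple by blast
      then show "\<forall>\<^sub>F n in sequentially. indicator (cball 0 (real n)) x *\<^sub>R weak_gradient v x = weak_gradient v x"
        by (intro eventually_sequentiallyI[of N]) simp
    qed
  qed
  then show ?thesis
    using v test_functions_subset_C2c
    unfolding homogeneous_H1_def H1_pair_def square_integrable_def mem_Collect_eq by blast
qed

section \<open>The estimate\<close>

lemma set_integral_ball_orthogonal_invariant:
  fixes f :: "real^'n::{finite,wellorder} \<Rightarrow> real" and R :: "real^'n::_ \<Rightarrow> real^'n::_"
  assumes R: "orthogonal_transformation R" and f: "f \<in> borel_measurable lebesgue"
    and inv: "AE x in lebesgue. f (R x) = f x"
  shows "(LINT x:ball (R p) r|lebesgue. f x) = (LINT x:ball p r|lebesgue. f x)"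
proof (rule set_integral_orthogonal_invariant[OF R f inv])
  have "dist (R p) (R x) = dist p x" for x
    using linear_diff[OF orthogonal_transformation_linear[OF R], of p x] orthogonal_transformation_norm[OF R, of "p - x"]
    by (simp add: dist_norm)
  then show "R x \<in> ball (R p) r \<longleftrightarrow> x \<in> ball p r" for x
    by simp
qed simp_all

text \<open>An isometry that permutes \<open>Z\<close> carries the cell of \<open>p\<close> to the
  cell of \<open>R p\<close>.\<close>

lemma set_integral_voronoi_cell_orthogonal_invariant:
  fixes f :: "real^'n::{finite,wellorder} \<Rightarrow> real" and R :: "real^'n::_ \<Rightarrow> real^'n::_"
  assumes R: "orthogonal_transformation R" and f: "f \<in> borel_measurable lebesgue"
    and inv: "AE x in lebesgue. f (R x) = f x" and Z: "finite Z" "R ` Z = Z"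
  shows "(LINT x:voronoi_cell Z (R p)|lebesgue. f x) = (LINT x:voronoi_cell Z p|lebesgue. f x)"
proof (rule set_integral_orthogonal_invariant[OF R f inv])
  have norm: "norm (R x - R q) = norm (x - q)" for x q
    using linear_diff[OF orthogonal_transformation_linear[OF R], of x q] orthogonal_transformation_norm[OF R, of "x - q"]
    by simp
  have "Z - {R p} = R ` (Z - {p})"
    using Z(2) orthogonal_transformation_inj[OF R] by (auto simp: inj_def)
  then show "R x \<in> voronoi_cell Z (R p) \<longleftrightarrow> x \<in> voronoi_cell Z p" for x
    by (simp add: voronoi_cell_def norm)
qed (intro voronoi_cell_measurable Z)+

lemma norm_square_real2: "(norm (x :: real^2))\<^sup>2 = (x $ 1)\<^sup>2 + (x $ 2)\<^sup>2"
  by (simp only: power2_norm_eq_inner inner_vec_def sum_2 inner_real_def flip: power2_eq_square)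

lemma Xi_eq_ring_point: "0 < j \<Longrightarrow> \<Xi> j k t = ring_point (sqrt (1 - t\<^sup>2 * (\<delta> k)\<^sup>2)) k (j - 1)"
  by (simp add: \<Xi>_def \<xi>_def ring_point_def vec_eq_iff forall_3 of_nat_diff)

text \<open>All ring points have third coordinate 0, so passing from the plane to space adds the
  same \<open>(x $ 3)\<^sup>2\<close> to every squared distance and preserves comparisons.\<close>

lemma cylinder_Omega_eq_voronoi_cell:
  fixes k t defines "s \<equiv> sqrt (1 - t\<^sup>2 * (\<delta> k)\<^sup>2)"
  assumes k: "0 < k" and s: "0 < s"
  shows "cylinder (\<Omega>\<^sub>1 k t) = voronoi_cell (ring_point s k ` {..<k}) (ring_point s k 0)"
proof -
  have n: "(norm (x - ring_point s k (j - 1)))\<^sup>2 = (norm (vector [x $ 1, x $ 2] - \<xi> j k t))\<^sup>2 + (x $ 3)\<^sup>2"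
    if "0 < j" for x :: "real^3" and j
    using that by (simp add: norm_square_real3 norm_square_real2 ring_point_def \<xi>_def s_def of_nat_diff)
  have less: "norm (vector [x $ 1, x $ 2] - \<xi> 1 k t) < norm (vector [x $ 1, x $ 2] - \<xi> j k t)
      \<longleftrightarrow> norm (x - ring_point s k 0) < norm (x - ring_point s k (j - 1))" if "0 < j" for x :: "real^3" and j
  proof -
    have sq: "a < b \<longleftrightarrow> a\<^sup>2 < b\<^sup>2" if "0 \<le> a" "0 \<le> b" for a b :: real
      using that power2_less_imp_less[of a b] power_strict_mono[of a b 2] by auto
    have n1: "(norm (x - ring_point s k 0))\<^sup>2 = (norm (vector [x $ 1, x $ 2] - \<xi> 1 k t))\<^sup>2 + (x $ 3)\<^sup>2"
      using n[of 1 x] by simp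
    show ?thesis
      unfolding sq[OF norm_ge_zero norm_ge_zero] n1 n[OF that] by simp
  qed
  \<comment> \<open>The cell omits its centre as a point, whereas \<open>\<Omega>\<^sub>1\<close>
    omits the index 1; distinctness of the ring points makes these the same, after the index shift
    by one.\<close>
  have "ring_point s k ` {..<k} - {ring_point s k 0} = (\<lambda>j. ring_point s k (j - 1)) ` {2..k}"
  proof (intro equalityI subsetI)
    fix q assume "q \<in> ring_point s k ` {..<k} - {ring_point s k 0}"
    then obtain j where "j < k" "j \<noteq> 0" "q = ring_point s k j"
      by (metis DiffE imageE insertI1 lessThan_iff)
    then show "q \<in> (\<lambda>j. ring_point s k (j - 1)) ` {2..k}"
      by (intro image_eqI[of _ _ "Suc j"]) auto
  next
    fix q assume "q \<in> (\<lambda>j. ring_point s k (j - 1)) ` {2..k}"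
    then obtain j where "2 \<le> j" "j \<le> k" "q = ring_point s k (j - 1)"
      by auto
    then show "q \<in> ring_point s k ` {..<k} - {ring_point s k 0}"
      using ring_point_neq[OF s, of "j - 1" k 0] by auto
  qed
  then show ?thesis
    using less by (auto simp: voronoi_cell_def cylinder_def \<Omega>\<^sub>1_def)
qed

lemma H1_sym_integral_estimates:
  fixes s \<rho> M :: real
  assumes k: "0 < k" and s: "0 < s" and \<rho>: "0 < \<rho>"
    and M: "\<And>x. (\<Sum>j<k. bubble \<rho> (ring_point s k j) x) \<le> M"
    and v: "v \<in> homogeneous_H1_sym k"
  shows "real k * (LINT x:ball (ring_point s k 0) (2 * \<rho>)|lebesgue. (v x)\<^sup>2)
      \<le> 25 * \<rho>\<^sup>2 * M * (LINT x|lebesgue. (norm (weak_gradient v x))\<^sup>2)"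
    and "(LINT x|lebesgue. (norm (weak_gradient v x))\<^sup>2)
      = real k * (LINT x:voronoi_cell (ring_point s k ` {..<k}) (ring_point s k 0)|lebesgue. (norm (weak_gradient v x))\<^sup>2)"
proof -
  let ?R = "rotation (2 * pi / real k)" and ?p = "ring_point s k" and ?G = "weak_gradient v"
  let ?Z = "?p ` {..<k}"
  note R = orthogonal_transformation_rotation[of "2 * pi / real k"]
  have "v \<in> homogeneous_H1" and "fold_symmetric k v"
    using v by (simp_all add: homogeneous_H1_sym_def)
  then have pair: "H1_pair v ?G" and inv: "AE x in lebesgue. v (?R x) = v x"
    using homogeneous_H1_imp_H1_pair fold_symmetric_AE by blast+
  have v_meas [measurable]: "v \<in> borel_measurable lebesgue" and G_meas [measurable]: "?G \<in> borel_measurable lebesgue"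
    and G_int: "integrable lebesgue (\<lambda>x. (norm (?G x))\<^sup>2)"
    using pair by (auto simp: H1_pair_def square_integrable_def)
  have v_inv: "AE x in lebesgue. (v (?R x))\<^sup>2 = (v x)\<^sup>2"
    using inv by eventually_elim simp
  have G_inv: "AE x in lebesgue. (norm (?G (?R x)))\<^sup>2 = (norm (?G x))\<^sup>2"
    using H1_pair_orthogonal_invariant[OF pair R inv] by eventually_elim simp
  have step: "?R (?p j) = ?p (Suc j)" for j
    using k by (rule rotation_ring_point)
  have ball: "(LINT x:ball (?p j) (2 * \<rho>)|lebesgue. (v x)\<^sup>2) = (LINT x:ball (?p 0) (2 * \<rho>)|lebesgue. (v x)\<^sup>2)" for j
  proof (induction j)
    case (Suc j)
    have "(LINT x:ball (?p (Suc j)) (2 * \<rho>)|lebesgue. (v x)\<^sup>2) = (LINT x:ball (?p j) (2 * \<rho>)|lebesgue. (v x)\<^sup>2)"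
      unfolding step[symmetric] by (rule set_integral_ball_orthogonal_invariant[OF R _ v_inv]) measurable
    with Suc.IH show ?case by simp
  qed simp
  have "(\<Sum>j<k. LINT x:ball (?p j) (2 * \<rho>)|lebesgue. (v x)\<^sup>2) \<le> 25 * \<rho>\<^sup>2 * M * (LINT x|lebesgue. (norm (?G x))\<^sup>2)"
    using k by (intro H1_pair_sum_ball_integral_le \<rho> M pair) auto
  moreover have "(\<Sum>j<k. LINT x:ball (?p j) (2 * \<rho>)|lebesgue. (v x)\<^sup>2)
      = (\<Sum>j<k. LINT x:ball (?p 0) (2 * \<rho>)|lebesgue. (v x)\<^sup>2)"
    by (rule sum.cong[OF refl ball])
  ultimately show "real k * (LINT x:ball (?p 0) (2 * \<rho>)|lebesgue. (v x)\<^sup>2)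
      \<le> 25 * \<rho>\<^sup>2 * M * (LINT x|lebesgue. (norm (?G x))\<^sup>2)"
    by (simp only: sum_constant card_lessThan)
  \<comment> \<open>Index \<open>k\<close> wraps around to index 0, so the shift by one permutes the
    ring.\<close>
  have RZ: "?R ` ?Z = ?Z"
  proof -
    have "?R ` ?Z = ?p ` (Suc ` {..<k})"
      by (simp only: image_image step)
    also have "Suc ` {..<k} = insert k {1..<k}"
      using k by (auto simp: image_Suc_lessThan)
    also have "?p ` \<dots> = ?p ` insert 0 {1..<k}"
      using ring_point_self[OF k, of s] by simp
    also have "insert 0 {1..<k} = {..<k}"
      using k by auto
    finally show ?thesis .
  qed
  have cell: "(LINT x:voronoi_cell ?Z (?p j)|lebesgue. (norm (?G x))\<^sup>2)
      = (LINT x:voronoi_cell ?Z (?p 0)|lebesgue. (norm (?G x))\<^sup>2)" for j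
  proof (induction j)
    case (Suc j)
    have "(LINT x:voronoi_cell ?Z (?p (Suc j))|lebesgue. (norm (?G x))\<^sup>2)
        = (LINT x:voronoi_cell ?Z (?p j)|lebesgue. (norm (?G x))\<^sup>2)"
      unfolding step[symmetric]
      using G_int by (intro set_integral_voronoi_cell_orthogonal_invariant[OF R _ G_inv _ RZ]) simp_all
    with Suc.IH show ?case by simp
  qed simp
  \<comment> \<open>Distinctness ensures that the ring has \<open>k\<close> cells, so the sum over
    points has \<open>k\<close> equal terms.\<close>
  have "inj_on ?p {..<k}"
    using ring_point_neq[OF s] by (intro inj_onI) (metis lessThan_iff)
  then have "(\<Sum>p\<in>?Z. LINT x:voronoi_cell ?Z p|lebesgue. (norm (?G x))\<^sup>2)
      = (\<Sum>j<k. LINT x:voronoi_cell ?Z (?p j)|lebesgue. (norm (?G x))\<^sup>2)"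
    by (rule sum.reindex_cong) simp_all
  also have "\<dots> = (\<Sum>j<k. LINT x:voronoi_cell ?Z (?p 0)|lebesgue. (norm (?G x))\<^sup>2)"
    by (rule sum.cong[OF refl cell])
  finally have "(\<Sum>p\<in>?Z. LINT x:voronoi_cell ?Z p|lebesgue. (norm (?G x))\<^sup>2)
      = real k * (LINT x:voronoi_cell ?Z (?p 0)|lebesgue. (norm (?G x))\<^sup>2)"
    by (simp only: sum_constant card_lessThan)
  moreover have "(LINT x|lebesgue. (norm (?G x))\<^sup>2)
      = (\<Sum>p\<in>?Z. LINT x:voronoi_cell ?Z p|lebesgue. (norm (?G x))\<^sup>2)"
    using k by (intro integral_eq_sum_voronoi_cells G_int) auto
  ultimately show "(LINT x|lebesgue. (norm (?G x))\<^sup>2)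
      = real k * (LINT x:voronoi_cell ?Z (?p 0)|lebesgue. (norm (?G x))\<^sup>2)"
    by (rule trans[rotated])
qed

text \<open>From \<open>k \<ge> 3 \<ge> exp 1\<close> one gets \<open>ln k \<ge> 1\<close>, and from
  \<open>k \<ge> 4 * b\<close> that \<open>t * \<delta> k \<le> 1 / 4\<close>, which keeps the ring
  radius above \<open>1 / 2\<close>. The factor 32 is 8 times 2 for the radius and 2 for
  \<open>1 + ln k \<le> 2 * ln k\<close>; what remains is
  \<open>\<rho> k ln k = sqrt t\<close>.\<close>

lemma scale_bounds:
  fixes b t :: real
  assumes t: "0 < t" "t \<le> b" and k: "3 \<le> k" "4 * b \<le> real k"
  defines "s \<equiv> sqrt (1 - t\<^sup>2 * (\<delta> k)\<^sup>2)" and "\<rho> \<equiv> sqrt (t * \<delta> k)"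
  shows "t * \<delta> k < 1" and "1 / 2 \<le> s" and "0 < \<rho>" and "\<rho>\<^sup>2 = t * \<delta> k"
    and "8 * \<rho> * real k / s * (1 + ln (real k)) \<le> 32 * sqrt b"
proof -
  have "exp 1 \<le> real k"
    using exp_le k(1) by linarith
  then have ln: "1 \<le> ln (real k)"
    using k(1) by (subst ln_ge_iff) auto
  have k0: "3 \<le> real k" "0 < real k" using k(1) by auto
  have kl: "real k \<le> real k * ln (real k)"
    using ln k0 by simp
  then have kl0: "0 < real k * ln (real k)"
    using k0 by linarith
  have \<delta>0: "0 < \<delta> k"
    unfolding \<delta>_def using kl0 by (intro divide_pos_pos zero_less_power) simp_all
  have "(real k)\<^sup>2 \<le> (real k * ln (real k))\<^sup>2"
    using kl k0 by (intro power_mono) auto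
  then have "\<delta> k \<le> 1 / (real k)\<^sup>2"
    unfolding \<delta>_def using k0 by (intro divide_left_mono) auto
  then have "t * \<delta> k \<le> b * (1 / (real k)\<^sup>2)"
    using t \<delta>0 by (intro mult_mono) auto
  also have "\<dots> \<le> real k / 4 * (1 / (real k)\<^sup>2)"
    using k(2) by (intro mult_right_mono) auto
  also have "\<dots> = 1 / (4 * real k)"
    using k0 by (simp add: power2_eq_square)
  also have "\<dots> \<le> 1 / 4"
    using k0 by (simp add: field_simps)
  finally have small: "t * \<delta> k \<le> 1 / 4" .
  then show "t * \<delta> k < 1" by simp
  have pos: "0 < t * \<delta> k" using t \<delta>0 by simp
  then show \<rho>0: "0 < \<rho>" by (simp add: \<rho>_def)
  show "\<rho>\<^sup>2 = t * \<delta> k"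
    unfolding \<rho>_def using pos by (intro real_sqrt_pow2) simp
  have "t\<^sup>2 * (\<delta> k)\<^sup>2 \<le> (1 / 4)\<^sup>2"
    unfolding power_mult_distrib[symmetric] using small pos by (intro power_mono) auto
  then have "(1 / 2)\<^sup>2 \<le> 1 - t\<^sup>2 * (\<delta> k)\<^sup>2"
    by (simp add: power2_eq_square)
  then show s: "1 / 2 \<le> s"
    unfolding s_def by (rule real_le_rsqrt)
  have "\<rho> = sqrt t / (real k * ln (real k))"
    unfolding \<rho>_def \<delta>_def using kl0 by (simp add: real_sqrt_divide)
  then have \<rho>kl: "\<rho> * real k * ln (real k) = sqrt t"
    using kl0 k(1) by auto
  have "8 * \<rho> * real k / s * (1 + ln (real k)) \<le> 8 * \<rho> * real k / (1 / 2) * (2 * ln (real k))"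
    using s \<rho>0 k0 ln by (intro mult_mono divide_left_mono) auto
  also have "\<dots> = 32 * (\<rho> * real k * ln (real k))"
    by simp
  also have "\<dots> \<le> 32 * sqrt b"
    unfolding \<rho>kl using t by simp
  finally show "8 * \<rho> * real k / s * (1 + ln (real k)) \<le> 32 * sqrt b" .
qed

theorem proposition2p2:
  fixes a b :: real
  assumes "0 < a" and "a < b"
  shows "\<exists>kstar::nat. \<exists>Cstar::real. 2 \<le> kstar \<and> 0 < Cstar \<and>
    (\<forall>k\<ge>kstar. \<forall>t\<in>{a..b}. t * \<delta> k < 1 \<and>
      (\<forall>v\<in>homogeneous_H1_sym k.
        1 / (t * \<delta> k) * (LINT x:ball (\<Xi> 1 k t) (2 * sqrt (t * \<delta> k))|lebesgue. \<bar>v x\<bar>\<^sup>2)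
          \<le> Cstar / real k * (LINT x|lebesgue. (norm (weak_gradient v x))\<^sup>2) \<and>
        Cstar / real k * (LINT x|lebesgue. (norm (weak_gradient v x))\<^sup>2)
          = Cstar * (LINT x:cylinder (\<Omega>\<^sub>1 k t)|lebesgue. (norm (weak_gradient v x))\<^sup>2)))"
proof (intro exI conjI allI impI ballI)
  \<comment> \<open>\<open>?K\<close> secures both lower bounds on \<open>k\<close> in
    \<open>scale_bounds\<close>. \<open>?M\<close> bounds the sum of bubbles: 1 for the nearest
    point and \<open>32 * sqrt b\<close> for all others. The 25 in the final constant is that of
    \<open>laplacian_bubble_le\<close>.\<close>
  let ?K = "3 + nat \<lceil>4 * b\<rceil>" and ?M = "1 + 32 * sqrt b"
  show "2 \<le> ?K" by simp
  show "0 < 25 * ?M" using assms by (simp add: add_pos_nonneg)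
  fix k t assume "?K \<le> k" and "t \<in> {a..b}"
  then have t: "0 < t" "t \<le> b" and k: "3 \<le> k" "4 * b \<le> real k"
    using assms by auto linarith
  define s \<rho> where "s = sqrt (1 - t\<^sup>2 * (\<delta> k)\<^sup>2)" and "\<rho> = sqrt (t * \<delta> k)"
  note bounds = scale_bounds[OF t k, folded s_def \<rho>_def]
  show "t * \<delta> k < 1" by (rule bounds(1))
  have s: "0 < s" using bounds(2) by simp
  have k0: "0 < k" "0 < real k" using k(1) by auto
  have M: "(\<Sum>j<k. bubble \<rho> (ring_point s k j) x) \<le> ?M" for x
    using sum_bubble_ring_point_le[OF bounds(3) s k0(1), of x] bounds(5) by linarith
  fix v assume v: "v \<in> homogeneous_H1_sym k"
  note est = H1_sym_integral_estimates[OF k0(1) s bounds(3) M v]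
  let ?D = "LINT x|lebesgue. (norm (weak_gradient v x))\<^sup>2"
  let ?I = "LINT x:ball (ring_point s k 0) (2 * \<rho>)|lebesgue. (v x)\<^sup>2"
  have "\<Xi> 1 k t = ring_point s k 0"
    by (simp add: Xi_eq_ring_point s_def)
  moreover have "1 / \<rho>\<^sup>2 * ?I \<le> 25 * ?M / real k * ?D"
  proof -
    have "?I \<le> 25 * \<rho>\<^sup>2 * ?M * ?D / real k"
      using est(1) k0(2) by (simp only: pos_le_divide_eq mult.commute)
    then have "1 / \<rho>\<^sup>2 * ?I \<le> 1 / \<rho>\<^sup>2 * (25 * \<rho>\<^sup>2 * ?M * ?D / real k)"
      by (rule mult_left_mono) simp
    also have "\<dots> = 25 * ?M / real k * ?D"
      using bounds(3) by simp
    finally show ?thesis .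
  qed
  ultimately show "1 / (t * \<delta> k) * (LINT x:ball (\<Xi> 1 k t) (2 * sqrt (t * \<delta> k))|lebesgue. \<bar>v x\<bar>\<^sup>2) \<le> 25 * ?M / real k * ?D"
    unfolding bounds(4)[symmetric] by (simp only: real_sqrt_abs power2_abs abs_of_pos[OF bounds(3)])
  \<comment> \<open>Equal distribution of the energy over the \<open>k\<close> cells, with the
    constant as a common factor.\<close>
  show "25 * ?M / real k * ?D = 25 * ?M * (LINT x:cylinder (\<Omega>\<^sub>1 k t)|lebesgue. (norm (weak_gradient v x))\<^sup>2)"
    unfolding est(2) cylinder_Omega_eq_voronoi_cell[OF k0(1) s[unfolded s_def], folded s_def] using k0(2) by simp
qed

end
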